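(* Let $\{Y_t\}_{t\ge 0}$ and $\{Z_t\}_{t\ge 0}$ be two independent Lévy processes on $\mathbb{R}^d$, let $0<q<p$, and let $\{X_t\}_{t\ge 0}$ be the semi-Lévy process with period $p$ defined by $X_0=0$ a.s. and, for $n=0,1,2,\dots$, $$X_t=\begin{cases}X_{np}+Y_t-Y_{np} & (np<t\le np+q),\\ X_{np+q}+Z_t-Z_{np+q} & (np+q<t\le (n+1)p).\end{cases}$$ Then $\{X_t\}_{t\ge 0}$ is recurrent if and only if the Lévy process $\{Y_{qt}+Z_{(p-q)t}\}_{t\ge 0}$ is recurrent.
   Context: An additive process on $\mathbb{R}^d$ is an $\mathbb{R}^d$-valued stochastic process $\{X_t\}_{t\ge 0}$ with $X_0=0$ a.s. that is stochastically continuous, has independent increments, and has sample paths that are right-continuous in $t\ge 0$ with left limits in $t>0$. A Lévy process is an additive process with stationary increments. A semi-Lévy process with period $p>0$ is an additive process such that $X_{t+p}-X_{s+p}$ and $X_t-X_s$ have the same distribution for all $s,t\ge 0$. An additive process $\{X_t\}_{t\ge0}$ is recurrent if $\liminf_{t\to\infty}|X_t-X_s|=0$ a.s. for every $s\ge 0$, where $|\cdot|$ is the Euclidean norm. *)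

theory Defs
  imports "HOL-Probability.Probability"
begin

(* Processes are indexed by real but every condition concerns times t >= 0 only; the values
   at negative times are unconstrained. R^d is an arbitrary Euclidean space, with d = DIM('a). *)

locale additive_process = prob_space M for M :: "'w measure" +
  fixes X :: "real \<Rightarrow> 'w \<Rightarrow> 'a::euclidean_space"
  assumes random_variable: "\<And>t. 0 \<le> t \<Longrightarrow> random_variable borel (X t)"
    and start: "AE w in M. X 0 w = 0"
    and stochastically_continuous:
      "\<And>t e. 0 \<le> t \<Longrightarrow> 0 < e \<Longrightarrow>
        ((\<lambda>s. prob {w \<in> space M. norm (X s w - X t w) > e}) \<longlongrightarrow> 0) (at t within {0..})"
    and independent_increments:
      "\<And>(n::nat) (t::nat \<Rightarrow> real). 0 \<le> t 0 \<Longrightarrow> (\<And>i. i < n \<Longrightarrow> t i < t (Suc i)) \<Longrightarrow>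
        indep_vars (\<lambda>_. borel) (\<lambda>i w. X (t (Suc i)) w - X (t i) w) {..<n}"
    and right_continuous:
      "\<And>w t. w \<in> space M \<Longrightarrow> 0 \<le> t \<Longrightarrow> ((\<lambda>s. X s w) \<longlongrightarrow> X t w) (at_right t)"
    and left_limits:
      "\<And>w t. w \<in> space M \<Longrightarrow> 0 < t \<Longrightarrow> \<exists>l. ((\<lambda>s. X s w) \<longlongrightarrow> l) (at_left t)"

locale levy_process = additive_process +
  assumes stationary_increments:
    "\<And>s t h. 0 \<le> s \<Longrightarrow> 0 \<le> t \<Longrightarrow> 0 \<le> h \<Longrightarrow>
      distr M borel (\<lambda>w. X (t + h) w - X (s + h) w) = distr M borel (\<lambda>w. X t w - X s w)"

locale semi_levy_process = additive_process +
  fixes p :: real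
  assumes period_pos: "0 < p"
    and periodic_increments:
    "\<And>s t. 0 \<le> s \<Longrightarrow> 0 \<le> t \<Longrightarrow>
      distr M borel (\<lambda>w. X (t + p) w - X (s + p) w) = distr M borel (\<lambda>w. X t w - X s w)"

definition recurrent_process ::
    "'w measure \<Rightarrow> (real \<Rightarrow> 'w \<Rightarrow> 'a::euclidean_space) \<Rightarrow> bool" where
  "recurrent_process M X \<longleftrightarrow>
    (\<forall>s\<ge>0. AE w in M. Liminf at_top (\<lambda>t. ereal (norm (X t w - X s w))) = 0)"

(* Independence of the whole processes, i.e. of the sigma-algebras generated by
   (Y t, t >= 0) and (Z t, t >= 0): joint independence as random elements of the product
   space, not merely independence of Y t and Z t for each t. *)
definition independent_processes ::
    "'w measure \<Rightarrow> (real \<Rightarrow> 'w \<Rightarrow> 'a::euclidean_space) \<Rightarrow>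
      (real \<Rightarrow> 'w \<Rightarrow> 'a) \<Rightarrow> bool" where
  "independent_processes M Y Z \<longleftrightarrow>
    prob_space.indep_var M
      (Pi\<^sub>M {0..} (\<lambda>_. borel)) (\<lambda>w. \<lambda>t\<in>{0..}. Y t w)
      (Pi\<^sub>M {0..} (\<lambda>_. borel)) (\<lambda>w. \<lambda>t\<in>{0..}. Z t w)"

end

theory Submission
  imports Defs
begin

text \<open>
  Write \<open>W\<close> for the process \<open>t \<mapsto> Y (q * t) + Z ((p - q) * t)\<close>. Both \<open>X\<close> and \<open>W\<close> are semi-Levy, with
  periods \<open>p\<close> and \<open>1\<close>. The argument compares them along multiples of their periods.

  Over \<open>n\<close> periods, \<open>X\<close> collects the increments of \<open>Y\<close> over \<open>n\<close> disjoint intervals of length \<open>q\<close> and the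
  increments of \<open>Z\<close> over \<open>n\<close> disjoint intervals of length \<open>p - q\<close>. So does \<open>W\<close>, with other intervals. As
  increments over disjoint intervals are independent and their laws depend only on the lengths, the
  variables \<open>X (n * p) - X 0\<close> and \<open>W n - W 0\<close> have the same law for every \<open>n\<close> (\<open>distr_skeletons\<close>).

  It remains to see that these laws decide recurrence. The criterion
  \<open>recurrent_iff_skeleton_not_summable\<close> says that a semi-Levy process \<open>V\<close> of period \<open>p\<close> is recurrent iff
  \<open>\<Sum>n. P (norm (V (n * p) - V 0) < c) = \<infinity>\<close> for some \<open>c\<close>. If \<open>V\<close> is recurrent, it visits the unit ball
  around \<open>V 0\<close> during infinitely many periods. When it does so during a period, then with probability at least
  \<open>1 / 2\<close> it is still within a fixed distance of that ball at the end of the period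
  (\<open>first_entrance_bound\<close>, with the tightness from \<open>increments_tight\<close>), and Borel-Cantelli excludes a
  convergent series. Conversely, for every \<open>s\<close> the walk \<open>V (s + n * p) - V s\<close> has independent, identically
  distributed steps and, from some \<open>n\<close> on, the same one-time laws as \<open>V (n * p) - V 0\<close>. A random walk with a
  divergent series returns to every neighbourhood of \<open>0\<close> infinitely often (\<open>random_walk_returns\<close>).

  That \<open>X\<close> and \<open>W\<close> are additive has a common reason, isolated in the locale \<open>superposition\<close>: on a bounded time
  interval both are, up to the value at time \<open>0\<close>, finite sums of copies of \<open>Y\<close> and \<open>Z\<close>, each run by a continuous nondecreasing clock,
  and different clocks of the same process run through disjoint stretches of its time.
\<close>

section \<open>Independent families and the laws of their sums\<close>

lemma (in prob_space) prob_indep_var_conj: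
  assumes "indep_var S A T B" "P \<in> sets S" "Q \<in> sets T"
  shows "prob {w \<in> space M. A w \<in> P \<and> B w \<in> Q}
       = prob {w \<in> space M. A w \<in> P} * prob {w \<in> space M. B w \<in> Q}"
proof -
  have "{w \<in> space M. A w \<in> P \<and> B w \<in> Q} = (\<lambda>x. (A x, B x)) -` (P \<times> Q) \<inter> space M"
    "{w \<in> space M. A w \<in> P} = A -` P \<inter> space M" "{w \<in> space M. B w \<in> Q} = B -` Q \<inter> space M"
    by auto
  then show ?thesis
    using indep_varD[OF assms] by simp
qed

lemma (in prob_space) prob_eq_of_distr_eq:
  assumes "distr M N A = distr M N B" "A \<in> measurable M N" "B \<in> measurable M N" "S \<in> sets N"
  shows "prob {w \<in> space M. A w \<in> S} = prob {w \<in> space M. B w \<in> S}"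
proof -
  have "measure (distr M N A) S = measure (distr M N B) S"
    using assms by simp
  moreover have "{w \<in> space M. A w \<in> S} = A -` S \<inter> space M" "{w \<in> space M. B w \<in> S} = B -` S \<inter> space M"
    by auto
  ultimately show ?thesis
    using measure_distr[OF assms(2,4)] measure_distr[OF assms(3,4)] by simp
qed

text \<open>Two families that are independent within themselves form one independent family when they are
  independent of each other as random vectors: every finite intersection of events splits into one factor
  from each family, and the product formula then applies within each.\<close>
lemma (in prob_space) indep_vars_Un:
  assumes F: "indep_vars N F I" "indep_vars N F J" and disj: "I \<inter> J = {}"
    and ind: "indep_var (PiM I N) (\<lambda>w. \<lambda>i\<in>I. F i w) (PiM J N) (\<lambda>w. \<lambda>i\<in>J. F i w)"
  shows "indep_vars N F (I \<union> J)"
  unfolding indep_vars_def2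
proof (intro conjI ballI indep_setsI)
  show rv: "random_variable (N i) (F i)" if "i \<in> I \<union> J" for i
    using F that by (auto simp: indep_vars_def2)
  then show "{F i -` A \<inter> space M |A. A \<in> sets (N i)} \<subseteq> events" if "i \<in> I \<union> J" for i
    using that by auto
  fix A K assume K: "K \<noteq> {}" "K \<subseteq> I \<union> J" "finite K"
    and A: "\<forall>j\<in>K. A j \<in> {F j -` A \<inter> space M |A. A \<in> sets (N j)}"
  then obtain S where S: "\<And>j. j \<in> K \<Longrightarrow> S j \<in> sets (N j)" "\<And>j. j \<in> K \<Longrightarrow> A j = F j -` S j \<inter> space M"
    by (simp add: Bex_def) metis
  define E where "E L = {w \<in> space M. \<forall>k\<in>K \<inter> L. F k w \<in> S k}" for L
  have E: "prob (E L) = (\<Prod>k\<in>K \<inter> L. prob (A k))" if L: "indep_vars N F L" for L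
  proof (cases "K \<inter> L = {}")
    case True then show ?thesis by (simp add: E_def prob_space)
  next
    case False
    then have "E L = (\<Inter>k\<in>K \<inter> L. F k -` S k \<inter> space M)"
      by (auto simp: E_def)
    moreover have "indep_vars N F (K \<inter> L)"
      using indep_vars_subset[OF L] by auto
    ultimately show ?thesis
      using indep_varsD_finite[of N F "K \<inter> L" S] False K S by auto
  qed
  define R where "R L = {f \<in> space (PiM L N). \<forall>k\<in>K \<inter> L. f k \<in> S k}" for L
  have R: "R L \<in> sets (PiM L N)" for L
  proof -
    have "Measurable.pred (PiM L N) (\<lambda>f. f k \<in> S k)" if "k \<in> K \<inter> L" for k
    proof -
      have [measurable]: "S k \<in> sets (N k)" using S that by auto
      have [measurable]: "(\<lambda>f. f k) \<in> measurable (PiM L N) (N k)" using that by simp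
      show ?thesis by measurable
    qed
    then show ?thesis unfolding R_def
      using K by (intro sets.sets_Collect_finite_All) (auto simp: pred_def)
  qed
  have ER: "E L = {w \<in> space M. (\<lambda>i\<in>L. F i w) \<in> R L}" if "L \<subseteq> I \<union> J" for L
    using that rv[THEN measurable_space] by (auto simp: E_def R_def space_PiM)
  have "(\<Inter>j\<in>K. A j) = {w \<in> space M. (\<lambda>i\<in>I. F i w) \<in> R I \<and> (\<lambda>i\<in>J. F i w) \<in> R J}"
  proof -
    have "(\<Inter>j\<in>K. A j) = E I \<inter> E J"
      using K S(2) by (auto simp: E_def)
    then show ?thesis using ER[of I] ER[of J] by auto
  qed
  then have "prob (\<Inter>j\<in>K. A j) = prob (E I) * prob (E J)"
    using prob_indep_var_conj[OF ind R R] ER[of I] ER[of J] by auto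
  also have "\<dots> = (\<Prod>k\<in>K \<inter> I. prob (A k)) * (\<Prod>k\<in>K \<inter> J. prob (A k))"
    using E F by simp
  also have "\<dots> = (\<Prod>k\<in>(K \<inter> I) \<union> (K \<inter> J). prob (A k))"
    using K disj by (intro prod.union_disjoint[symmetric]) auto
  also have "(K \<inter> I) \<union> (K \<inter> J) = K"
    using K by auto
  finally show "prob (\<Inter>j\<in>K. A j) = (\<Prod>j\<in>K. prob (A j))" .
qed

lemma (in prob_space) indep_vars_group_sums:
  fixes D :: "'i \<Rightarrow> 'a \<Rightarrow> 'b::euclidean_space"
  assumes D: "indep_vars (\<lambda>_. borel) D I"
    and K: "\<And>j. j \<in> J \<Longrightarrow> K j \<subseteq> I" "disjoint_family_on K J" "\<And>j. j \<in> J \<Longrightarrow> finite (K j)"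
  shows "indep_vars (\<lambda>_. borel) (\<lambda>j w. \<Sum>i\<in>K j. D i w) J"
proof -
  have "indep_vars (\<lambda>_. borel) (\<lambda>j w. (\<lambda>f. \<Sum>i\<in>K j. f i) (\<lambda>i\<in>K j. D i w)) J"
  proof (rule indep_vars_compose2[OF indep_vars_restrict[OF D K(1,2)]])
    show "(\<lambda>f. \<Sum>i\<in>K j. f i :: 'b) \<in> borel_measurable (PiM (K j) (\<lambda>_. borel))" if "j \<in> J" for j
      by (rule borel_measurable_sum[where f="\<lambda>i f. f i"]) (rule measurable_component_singleton)
  qed
  then show ?thesis
    by simp
qed

text \<open>The joint law of an independent family is the product of the marginal laws, so it is determined by them.\<close>
lemma (in prob_space) distr_vector_cong:
  assumes "indep_vars N F I" "indep_vars N G I" "\<And>i. i \<in> I \<Longrightarrow> distr M (N i) (F i) = distr M (N i) (G i)"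
  shows "distr M (PiM I N) (\<lambda>w. \<lambda>i\<in>I. F i w) = distr M (PiM I N) (\<lambda>w. \<lambda>i\<in>I. G i w)"
proof (cases "I = {}")
  case True
  then show ?thesis by (simp add: restrict_def)
next
  case False
  have rv: "\<And>i. i \<in> I \<Longrightarrow> random_variable (N i) (F i)" "\<And>i. i \<in> I \<Longrightarrow> random_variable (N i) (G i)"
    using assms by (auto simp: indep_vars_def2)
  show ?thesis
    using indep_vars_iff_distr_eq_PiM'[where X=F, OF False rv(1)]
      indep_vars_iff_distr_eq_PiM'[where X=G, OF False rv(2)] assms
    by (metis (no_types, lifting) PiM_cong)
qed

lemma (in prob_space) distr_sum_cong:
  fixes F G :: "'i \<Rightarrow> 'a \<Rightarrow> 'b::euclidean_space"
  assumes ind: "indep_vars (\<lambda>_. borel) F I" "indep_vars (\<lambda>_. borel) G I"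
    and eq: "\<And>i. i \<in> I \<Longrightarrow> distr M borel (F i) = distr M borel (G i)"
  shows "distr M borel (\<lambda>w. \<Sum>i\<in>I. F i w) = distr M borel (\<lambda>w. \<Sum>i\<in>I. G i w)"
proof -
  have m: "(\<lambda>w. \<lambda>i\<in>I. F i w) \<in> measurable M (PiM I (\<lambda>_. borel))"
    "(\<lambda>w. \<lambda>i\<in>I. G i w) \<in> measurable M (PiM I (\<lambda>_. borel))"
    using ind by (auto simp: indep_vars_def2 intro!: measurable_restrict)
  have s: "(\<lambda>f. \<Sum>i\<in>I. f i :: 'b) \<in> borel_measurable (PiM I (\<lambda>_. borel))"
    by (rule borel_measurable_sum[where f="\<lambda>i f. f i"]) (rule measurable_component_singleton)
  have "distr (distr M (PiM I (\<lambda>_. borel)) (\<lambda>w. \<lambda>i\<in>I. F i w)) borel (\<lambda>f. \<Sum>i\<in>I. f i)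
     = distr (distr M (PiM I (\<lambda>_. borel)) (\<lambda>w. \<lambda>i\<in>I. G i w)) borel (\<lambda>f. \<Sum>i\<in>I. f i)"
    using distr_vector_cong[OF ind eq] by simp
  then show ?thesis
    using m s by (simp add: distr_distr comp_def)
qed

lemma (in prob_space) indep_vars_cong_space:
  assumes "\<And>i w. i \<in> I \<Longrightarrow> w \<in> space M \<Longrightarrow> F i w = G i w"
  shows "indep_vars N F I \<longleftrightarrow> indep_vars N G I"
proof -
  have "{F i -` A \<inter> space M |A. A \<in> sets (N i)} = {G i -` A \<inter> space M |A. A \<in> sets (N i)}" if "i \<in> I" for i
  proof -
    have "F i -` A \<inter> space M = G i -` A \<inter> space M" for A
      using assms that by auto
    then show ?thesis by simp
  qed
  moreover have "F i \<in> measurable M (N i) \<longleftrightarrow> G i \<in> measurable M (N i)" if "i \<in> I" for i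
    using assms that by (intro measurable_cong) auto
  ultimately show ?thesis
    unfolding indep_vars_def2 by (intro conj_cong ball_cong indep_sets_cong) auto
qed

lemma distr_increments_swap:
  fixes A B :: "'w \<Rightarrow> 'a::euclidean_space"
  assumes [measurable]: "A \<in> borel_measurable M" "B \<in> borel_measurable M"
      "A' \<in> borel_measurable M" "B' \<in> borel_measurable M"
    and eq: "distr M borel (\<lambda>w. B' w - A' w) = distr M borel (\<lambda>w. B w - A w)"
  shows "distr M borel (\<lambda>w. A' w - B' w) = distr M borel (\<lambda>w. A w - B w)"
proof -
  have "distr (distr M borel (\<lambda>w. B' w - A' w)) borel uminus = distr (distr M borel (\<lambda>w. B w - A w)) borel uminus"
    using eq by simp
  then show ?thesis
    by (simp add: distr_distr comp_def)
qed

section \<open>Increments of an additive process over disjoint intervals\<close>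

text \<open>The intervals need not be consecutive or listed in order, and some may be empty. All of their
  endpoints together form one increasing sequence of times, whose consecutive increments are independent by
  definition; each given increment is the sum of a block of these, and the blocks are disjoint.\<close>
lemma (in additive_process) indep_vars_disjoint_increments:
  assumes J: "finite J" and ab: "\<And>j. j \<in> J \<Longrightarrow> 0 \<le> a j \<and> a j \<le> b j"
    and disj: "disjoint_family_on (\<lambda>j. {a j<..b j}) J"
  shows "indep_vars (\<lambda>_. borel) (\<lambda>j w. X (b j) w - X (a j) w) J"
proof -
  define S where "S = insert 0 (a ` J \<union> b ` J)"
  define t where "t i = sorted_list_of_set S ! i" for i
  define m where "m = card S - 1"
  have fin: "finite S" and ne: "S \<noteq> {}" using J by (auto simp: S_def)
  have card: "card S = Suc m" using fin ne by (auto simp: m_def card_gt_0_iff)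
  (* \<open>t 0 < ... < t m\<close> enumerates \<open>S\<close>; including \<open>0\<close> in \<open>S\<close> makes it nonempty even if \<open>J\<close> is empty. *)
  have t_less: "t i < t j" if "i < j" "j \<le> m" for i j
    using sorted_wrt_nth_less[OF strict_sorted_list_of_set[of S], of i j] that card
    by (simp add: t_def)
  have t_le: "t i \<le> t j \<longleftrightarrow> i \<le> j" if "i \<le> m" "j \<le> m" for i j
    using t_less[of i j] t_less[of j i] that by (cases i j rule: linorder_cases) auto
  have t_in: "t i \<in> S" if "i \<le> m" for i
    using that card fin by (metis t_def less_Suc_eq_le nth_mem set_sorted_list_of_set length_sorted_list_of_set)
  have t_ex: "\<exists>i\<le>m. t i = x" if "x \<in> S" for x
    using that card fin
    by (metis t_def less_Suc_eq_le in_set_conv_nth set_sorted_list_of_set length_sorted_list_of_set)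
  have S0: "x \<ge> 0" if "x \<in> S" for x
    using that ab by (force simp: S_def)
  have D: "indep_vars (\<lambda>_. borel) (\<lambda>i w. X (t (Suc i)) w - X (t i) w) {..<m}"
    using t_less S0[OF t_in[of 0]] by (intro independent_increments) auto
  define K where "K j = {i. i < m \<and> a j \<le> t i \<and> t (Suc i) \<le> b j}" for j
  have "indep_vars (\<lambda>_. borel) (\<lambda>j w. \<Sum>i\<in>K j. X (t (Suc i)) w - X (t i) w) J"
  proof (rule indep_vars_group_sums[OF D])
    show "K j \<subseteq> {..<m}" for j by (auto simp: K_def)
    then show "finite (K j)" for j by (rule finite_subset) simp
    show "disjoint_family_on K J"
    proof (clarsimp simp: disjoint_family_on_def, rule ccontr)
      fix j j' assume j: "j \<in> J" "j' \<in> J" "j \<noteq> j'" "K j \<inter> K j' \<noteq> {}"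
      then obtain i where i: "i < m" "a j \<le> t i" "t (Suc i) \<le> b j" "a j' \<le> t i" "t (Suc i) \<le> b j'"
        by (auto simp: K_def)
      then have "t (Suc i) \<in> {a j<..b j} \<inter> {a j'<..b j'}"
        using t_less[of i "Suc i"] by auto
      moreover have "{a j<..b j} \<inter> {a j'<..b j'} = {}"
        using disj j(1-3) unfolding disjoint_family_on_def by blast
      ultimately show False by blast
    qed
  qed
  moreover have "(\<Sum>i\<in>K j. X (t (Suc i)) w - X (t i) w) = X (b j) w - X (a j) w" if j: "j \<in> J" for j w
  proof -
    obtain u v where uv: "u \<le> m" "v \<le> m" "t u = a j" "t v = b j"
      using t_ex[of "a j"] t_ex[of "b j"] j by (auto simp: S_def)
    then have "u \<le> v" using t_le[of u v] ab[OF j] by simp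
    have "K j = {u..<v}"
    proof -
      have "i \<in> K j \<longleftrightarrow> i \<in> {u..<v}" for i
      proof (cases "i < m")
        case True
        then show ?thesis
          unfolding K_def uv(3,4)[symmetric] using t_le[of u i] t_le[of "Suc i" v] uv by auto
      next
        case False
        then show ?thesis using uv by (auto simp: K_def)
      qed
      then show ?thesis by blast
    qed
    then show ?thesis
      using sum_Suc_diff'[OF \<open>u \<le> v\<close>, of "\<lambda>i. X (t i) w"] uv by simp
  qed
  ultimately show ?thesis
    by (subst indep_vars_cong[OF refl _ refl, where Y="\<lambda>j w. \<Sum>i\<in>K j. X (t (Suc i)) w - X (t i) w"])
      (auto simp: fun_eq_iff)
qed

section \<open>A recurrence criterion for random walks\<close>

text \<open>Consider the times \<open>m \<le> N\<close> at which the walk is in the ball but at distance at least \<open>\<epsilon>\<close> from its current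
  position from \<open>k\<close> up to \<open>N\<close> steps later. Two points of the ball are less than \<open>\<epsilon>\<close> apart, so two such times
  differ by less than \<open>k\<close>, and there are at most \<open>k\<close> of them. The left-hand side is the expected number of such
  times, because the walk restarts independently at time \<open>m\<close>. Cutting the future off at \<open>N\<close> steps keeps every
  event dependent on finitely many steps only.\<close>
lemma (in prob_space) escape_bound:
  fixes \<xi> :: "nat \<Rightarrow> 'a \<Rightarrow> 'b::euclidean_space" and \<epsilon> :: real
  defines "S \<equiv> \<lambda>n w. \<Sum>i<n. \<xi> i w"
  assumes ind: "\<And>n. indep_vars (\<lambda>_. borel) \<xi> {..<n}"
    and id: "\<And>i. distr M borel (\<xi> i) = distr M borel (\<xi> 0)"
  shows "(\<Sum>m\<le>N. prob {w \<in> space M. S m w \<in> ball x (\<epsilon> / 2)}) *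
           prob {w \<in> space M. \<forall>n\<in>{k..N}. \<epsilon> \<le> norm (S n w)} \<le> real k"
proof -
  have [measurable]: "\<xi> i \<in> borel_measurable M" for i
    using ind[of "Suc i"] by (auto simp: indep_vars_def2)
  have [measurable]: "S n \<in> borel_measurable M" for n
    unfolding S_def by measurable
  define B where "B = ball x (\<epsilon> / 2)"
  have [measurable]: "B \<in> sets borel" by (simp add: B_def)
  define G where "G m = {w \<in> space M. S m w \<in> B \<and> (\<forall>n\<in>{k..N}. \<epsilon> \<le> norm (S (m + n) w - S m w))}" for m
  have G_sets[measurable]: "G m \<in> events" for m
    unfolding G_def by measurable
  have shift: "S (m + n) w - S m w = (\<Sum>i<n. \<xi> (m + i) w)" for m n w
  proof -
    have "S (m + n) w = S m w + (\<Sum>i\<in>{m..<m + n}. \<xi> i w)"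
      unfolding S_def lessThan_atLeast0 by (rule sum.atLeastLessThan_concat[symmetric]) auto
    also have "(\<Sum>i\<in>{m..<m + n}. \<xi> i w) = (\<Sum>i<n. \<xi> (m + i) w)"
      using sum.shift_bounds_nat_ivl[of "\<lambda>i. \<xi> i w" 0 m n] by (simp add: lessThan_atLeast0 add.commute)
    finally show ?thesis by simp
  qed
  define R where "R = {f \<in> space (PiM {..<N} (\<lambda>_. borel :: 'b measure)). \<forall>n\<in>{k..N}. \<epsilon> \<le> norm (\<Sum>i<n. f i)}"
  have R: "R \<in> sets (PiM {..<N} (\<lambda>_. borel))"
  proof -
    have "(\<lambda>f. norm (\<Sum>i<n. f i :: 'b)) \<in> borel_measurable (PiM {..<N} (\<lambda>_. borel))" if "n \<le> N" for n
    proof -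
      have "(\<lambda>f. \<Sum>i<n. f i :: 'b) \<in> borel_measurable (PiM {..<N} (\<lambda>_. borel))"
        by (rule borel_measurable_sum[where f="\<lambda>i f. f i"], rule measurable_component_singleton)
          (use that in auto)
      then show ?thesis by (rule measurable_compose) measurable
    qed
    then show ?thesis
      unfolding R_def by (intro sets.sets_Collect_finite_All) (auto intro!: borel_measurable_le)
  qed
  have prob_G: "prob (G m) = prob {w \<in> space M. S m w \<in> B} *
      prob {w \<in> space M. \<forall>n\<in>{k..N}. \<epsilon> \<le> norm (S n w)}" for m
  proof -
    have meas_vec: "(\<lambda>w. \<lambda>i\<in>{..<N}. \<xi> (m + i) w) \<in> measurable M (PiM {..<N} (\<lambda>_. borel))" for m
      by measurable
    (* \<open>R\<close> is the escape event as a set of step vectors. The steps after time \<open>m\<close> have the law of the first \<open>N\<close>. *)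
    have vec_in: "(\<lambda>i\<in>{..<N}. \<xi> (m + i) w) \<in> R \<longleftrightarrow> (\<forall>n\<in>{k..N}. \<epsilon> \<le> norm (S (m + n) w - S m w))" for m w
    proof -
      have "(\<Sum>i<n. (\<lambda>i\<in>{..<N}. \<xi> (m + i) w) i) = S (m + n) w - S m w" if "n \<le> N" for n
        unfolding shift using that by (intro sum.cong) auto
      then show ?thesis by (auto simp: R_def space_PiM)
    qed
    have same_law: "distr M borel (\<xi> (m + i)) = distr M borel (\<xi> i)" for i
      using id[of "m + i"] id[of i] by (rule trans[OF _ sym])
    have "indep_vars (\<lambda>_. borel) (\<lambda>j w. \<Sum>i\<in>{m + j}. \<xi> i w) {..<N}"
      by (intro indep_vars_group_sums[OF ind[of "m + N"]]) (auto simp: disjoint_family_on_def)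
    then have "distr M (PiM {..<N} (\<lambda>_. borel)) (\<lambda>w. \<lambda>i\<in>{..<N}. \<xi> (m + i) w)
        = distr M (PiM {..<N} (\<lambda>_. borel)) (\<lambda>w. \<lambda>i\<in>{..<N}. \<xi> (0 + i) w)"
      using ind[of N] same_law by (intro distr_vector_cong) auto
    from prob_eq_of_distr_eq[OF this meas_vec meas_vec R]
    have stat: "prob {w \<in> space M. \<forall>n\<in>{k..N}. \<epsilon> \<le> norm (S (m + n) w - S m w)}
        = prob {w \<in> space M. \<forall>n\<in>{k..N}. \<epsilon> \<le> norm (S n w)}"
      unfolding vec_in by (simp add: S_def)
    define P where "P = (\<lambda>f. \<Sum>i<m. f i) -` B \<inter> space (PiM {..<m} (\<lambda>_. borel))"
    define Q where "Q = (\<lambda>f. \<lambda>i\<in>{..<N}. f (m + i)) -` R \<inter> space (PiM {m..<m + N} (\<lambda>_. borel))"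
    have P: "P \<in> sets (PiM {..<m} (\<lambda>_. borel))" unfolding P_def
      by (intro measurable_sets[OF borel_measurable_sum[where f="\<lambda>i f. f i"]] measurable_component_singleton) auto
    have Q: "Q \<in> sets (PiM {m..<m + N} (\<lambda>_. borel))" unfolding Q_def
      by (intro measurable_sets[OF measurable_restrict R] measurable_component_singleton) auto
    have "indep_var (PiM {..<m} (\<lambda>_. borel)) (\<lambda>w. \<lambda>i\<in>{..<m}. \<xi> i w)
        (PiM {m..<m + N} (\<lambda>_. borel)) (\<lambda>w. \<lambda>i\<in>{m..<m + N}. \<xi> i w)"
      by (rule indep_var_restrict[OF ind[of "m + N"]]) auto
    from prob_indep_var_conj[OF this P Q]
    have "prob {w \<in> space M. (\<lambda>i\<in>{..<m}. \<xi> i w) \<in> P \<and> (\<lambda>i\<in>{m..<m + N}. \<xi> i w) \<in> Q}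
        = prob {w \<in> space M. (\<lambda>i\<in>{..<m}. \<xi> i w) \<in> P} *
          prob {w \<in> space M. (\<lambda>i\<in>{m..<m + N}. \<xi> i w) \<in> Q}" .
    moreover have "(\<lambda>i\<in>{..<m}. \<xi> i w) \<in> P \<longleftrightarrow> S m w \<in> B" for w
      by (simp add: P_def space_PiM S_def)
    moreover have "(\<lambda>i\<in>{m..<m + N}. \<xi> i w) \<in> Q \<longleftrightarrow> (\<forall>n\<in>{k..N}. \<epsilon> \<le> norm (S (m + n) w - S m w))" for w
    proof -
      have "(\<lambda>i\<in>{..<N}. (\<lambda>i\<in>{m..<m + N}. \<xi> i w) (m + i)) = (\<lambda>i\<in>{..<N}. \<xi> (m + i) w)"
        by (auto simp: fun_eq_iff)
      then show ?thesis
        unfolding vec_in[symmetric] by (simp add: Q_def space_PiM)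
    qed
    ultimately show ?thesis
      using stat by (simp add: G_def)
  qed
  have count: "(\<Sum>m\<le>N. indicator (G m) w) \<le> real k" for w
  proof -
    define I where "I = {m. m \<le> N \<and> w \<in> G m}"
    have fin: "finite I" by (simp add: I_def)
    have "card I \<le> k"
    proof (cases "I = {}")
      case False
      define m0 where "m0 = Min I"
      have m0: "m0 \<in> I" "\<And>m. m \<in> I \<Longrightarrow> m0 \<le> m"
        using fin False by (auto simp: m0_def)
      (* Here the horizon \<open>N\<close> is used: all times in \<open>I\<close> are at most \<open>N\<close>, so the later one lies within the horizon
         of the first. *)
      have "I \<subseteq> {m0..<m0 + k}"
      proof (rule ccontr)
        assume "\<not> I \<subseteq> {m0..<m0 + k}"
        then obtain m where m: "m \<in> I" "m0 + k \<le> m"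
          using m0 by force
        then have "m - m0 \<in> {k..N}" by (auto simp: I_def)
        then have "\<epsilon> \<le> norm (S (m0 + (m - m0)) w - S m0 w)"
          using m0 by (auto simp: I_def G_def)
        moreover have "m0 + (m - m0) = m" using m by simp
        ultimately have "\<epsilon> \<le> dist (S m w) (S m0 w)"
          by (simp add: dist_norm)
        moreover have "dist x (S m w) < \<epsilon> / 2" "dist x (S m0 w) < \<epsilon> / 2"
          using m m0 by (auto simp: I_def G_def B_def)
        ultimately show False
          using dist_triangle_half_r[of x "S m w" \<epsilon> "S m0 w"] by simp
      qed
      then show ?thesis
        using card_mono[of "{m0..<m0 + k}" I] by simp
    qed simp
    moreover have "(\<Sum>m\<le>N. indicator (G m) w) = real (card I)"
    proof -
      have "(\<Sum>m\<le>N. indicator (G m) w) = (\<Sum>m\<in>I. 1 :: real)"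
        by (rule sum.mono_neutral_cong_right) (auto simp: I_def indicator_def)
      then show ?thesis by simp
    qed
    ultimately show ?thesis by simp
  qed
  have "(\<Sum>m\<le>N. prob (G m)) = expectation (\<lambda>w. \<Sum>m\<le>N. indicator (G m) w)"
    by (subst Bochner_Integration.integral_sum) (auto simp: emeasure_eq_measure)
  also have "\<dots> \<le> expectation (\<lambda>w. real k)"
    using count by (intro integral_mono) (auto simp: emeasure_eq_measure)
  also have "\<dots> = real k" by (simp add: prob_space)
  finally show ?thesis
    by (simp add: prob_G sum_distrib_right B_def)
qed

text \<open>This is the divergence half of the recurrence dichotomy for random walks. Cover the ball of radius \<open>c\<close> by
  finitely many balls of diameter \<open>\<epsilon>\<close>. The series diverges for one of them, and by \<open>escape_bound\<close> the
  probability of staying at distance \<open>\<epsilon>\<close> from the origin after time \<open>k\<close> is at most \<open>k\<close> divided by any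
  partial sum of that series, hence \<open>0\<close>.\<close>
lemma (in prob_space) random_walk_returns:
  fixes \<xi> :: "nat \<Rightarrow> 'a \<Rightarrow> 'b::euclidean_space" and \<epsilon> c :: real
  defines "S \<equiv> \<lambda>n w. \<Sum>i<n. \<xi> i w"
  assumes ind: "\<And>n. indep_vars (\<lambda>_. borel) \<xi> {..<n}"
    and id: "\<And>i. distr M borel (\<xi> i) = distr M borel (\<xi> 0)"
    and div: "\<not> summable (\<lambda>n. prob {w \<in> space M. norm (S n w) < c})"
    and \<epsilon>: "0 < \<epsilon>"
  shows "AE w in M. \<exists>\<^sub>F n in sequentially. norm (S n w) < \<epsilon>"
proof -
  have [measurable]: "\<xi> i \<in> borel_measurable M" for i
    using ind[of "Suc i"] by (auto simp: indep_vars_def2)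
  have [measurable]: "S n \<in> borel_measurable M" for n
    unfolding S_def by measurable
  obtain C where C: "finite C" "cball 0 c \<subseteq> (\<Union>x\<in>C. ball x (\<epsilon> / 2) :: 'b set)"
    using compact_cball[of "0::'b" c] \<epsilon> unfolding compact_eq_totally_bounded by (metis half_gt_zero)
  obtain x where x: "\<not> summable (\<lambda>n. prob {w \<in> space M. S n w \<in> ball x (\<epsilon> / 2)})"
  proof (rule ccontr)
    assume "\<not> thesis"
    then have "summable (\<lambda>n. \<Sum>x\<in>C. prob {w \<in> space M. S n w \<in> ball x (\<epsilon> / 2)})"
      using that by (intro summable_sum) auto
    then have "summable (\<lambda>n. prob {w \<in> space M. norm (S n w) < c})"
    proof (rule summable_comparison_test'[where N=0])
      fix n
      have "prob {w \<in> space M. norm (S n w) < c} \<le> prob (\<Union>x\<in>C. {w \<in> space M. S n w \<in> ball x (\<epsilon> / 2)})"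
      proof (rule finite_measure_mono)
        show "{w \<in> space M. norm (S n w) < c} \<subseteq> (\<Union>x\<in>C. {w \<in> space M. S n w \<in> ball x (\<epsilon> / 2)})"
          using C(2) by (auto simp: subset_iff)
      qed (use C(1) in \<open>auto intro!: sets.finite_UN\<close>)
      also have "\<dots> \<le> (\<Sum>x\<in>C. prob {w \<in> space M. S n w \<in> ball x (\<epsilon> / 2)})"
        using C(1) by (intro measure_UNION_le) auto
      finally show "norm (prob {w \<in> space M. norm (S n w) < c})
          \<le> (\<Sum>x\<in>C. prob {w \<in> space M. S n w \<in> ball x (\<epsilon> / 2)})"
        by simp
    qed
    then show False using div by simp
  qed
  define \<rho> where "\<rho> k = prob {w \<in> space M. \<forall>n\<ge>k. \<epsilon> \<le> norm (S n w)}" for k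
  have "\<rho> k = 0" for k
  proof (rule ccontr)
    assume "\<rho> k \<noteq> 0"
    then have pos: "0 < \<rho> k" by (simp add: \<rho>_def zero_less_measure_iff)
    have "(\<Sum>m\<le>N. prob {w \<in> space M. S m w \<in> ball x (\<epsilon> / 2)}) \<le> real k / \<rho> k" for N
    proof -
      have "(\<Sum>m\<le>N. prob {w \<in> space M. S m w \<in> ball x (\<epsilon> / 2)}) * \<rho> k
        \<le> (\<Sum>m\<le>N. prob {w \<in> space M. S m w \<in> ball x (\<epsilon> / 2)}) *
           prob {w \<in> space M. \<forall>n\<in>{k..N}. \<epsilon> \<le> norm (S n w)}"
        unfolding \<rho>_def by (intro mult_left_mono finite_measure_mono sum_nonneg) auto
      also have "\<dots> \<le> real k"
        using escape_bound[OF ind id] unfolding S_def .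
      finally show ?thesis using pos by (simp add: field_simps)
    qed
    then have "summable (\<lambda>m. prob {w \<in> space M. S m w \<in> ball x (\<epsilon> / 2)})"
      by (intro bounded_imp_summable) auto
    then show False using x by simp
  qed
  then have "AE w in M. \<not> (\<forall>n\<ge>k. \<epsilon> \<le> norm (S n w))" for k
    unfolding \<rho>_def by (subst (asm) prob_Collect_eq_0) auto
  then have "AE w in M. \<forall>k. \<not> (\<forall>n\<ge>k. \<epsilon> \<le> norm (S n w))"
    by (simp add: AE_all_countable)
  then show ?thesis
    by eventually_elim (auto simp: frequently_sequentially not_le)
qed

section \<open>Recurrence of a semi-Levy process in terms of its skeleton\<close>

lemma (in prob_space) norm_tail_small:
  fixes V :: "'a \<Rightarrow> 'b::euclidean_space"
  assumes [measurable]: "V \<in> borel_measurable M" and "0 < e"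
  shows "\<exists>b::nat. prob {w \<in> space M. real b < norm (V w)} < e"
proof -
  have "(\<lambda>b::nat. prob {w \<in> space M. real b < norm (V w)}) \<longlonglongrightarrow> prob (\<Inter>b::nat. {w \<in> space M. real b < norm (V w)})"
    by (rule finite_Lim_measure_decseq) (auto simp: decseq_def)
  also have "(\<Inter>b::nat. {w \<in> space M. real b < norm (V w)}) = {}"
  proof -
    have "\<exists>b::nat. \<not> real b < norm (V w)" for w
      using reals_Archimedean2[of "norm (V w)"] by (auto simp: not_less intro: less_imp_le)
    then show ?thesis by fast
  qed
  finally have "\<forall>\<^sub>F b::nat in sequentially. prob {w \<in> space M. real b < norm (V w)} < e"
    using \<open>0 < e\<close> by (intro order_tendstoD) auto
  then show ?thesis
    unfolding eventually_sequentially by blast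
qed

text \<open>An inequality of Ottaviani type. Decompose according to the first index \<open>j \<ge> l\<close> at which the partial sum
  enters the ball of radius \<open>a\<close>. This event depends on the first \<open>j\<close> steps only, and independently of it the
  remaining steps add up to at most \<open>b\<close> with probability at least \<open>1 / 2\<close>.\<close>
lemma (in prob_space) first_entrance_bound:
  fixes D :: "nat \<Rightarrow> 'a \<Rightarrow> 'b::euclidean_space" and a b :: real
  defines "U \<equiv> \<lambda>j w. \<Sum>i<j. D i w"
  assumes ind: "indep_vars (\<lambda>_. borel) D {..<n}"
    and tight: "\<And>j. j \<in> {l..n} \<Longrightarrow> prob {w \<in> space M. b < norm (U n w - U j w)} \<le> 1 / 2"
  shows "prob {w \<in> space M. \<exists>j\<in>{l..n}. norm (U j w) < a} \<le> 2 * prob {w \<in> space M. norm (U n w) < a + b}"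
proof -
  have D[measurable]: "D i \<in> borel_measurable M" if "i < n" for i
    using ind that by (auto simp: indep_vars_def2)
  have U[measurable]: "U j \<in> borel_measurable M" if "j \<le> n" for j
    unfolding U_def using that by (intro borel_measurable_sum) auto
  (* \<open>P j\<close> and \<open>Q j\<close> are the events \<open>E j\<close> and \<open>H j\<close> below, as sets of vectors of steps. *)
  define P where "P j = {f \<in> space (PiM {..<j} (\<lambda>_. borel :: 'b measure)).
      (\<forall>i\<in>{l..<j}. a \<le> norm (\<Sum>r<i. f r)) \<and> norm (\<Sum>r<j. f r) < a}" for j
  define Q where "Q j = {f \<in> space (PiM {j..<n} (\<lambda>_. borel :: 'b measure)). norm (\<Sum>r\<in>{j..<n}. f r) \<le> b}" for j
  have part[measurable]: "(\<lambda>f. norm (\<Sum>r\<in>R. f r :: 'b)) \<in> borel_measurable (PiM K (\<lambda>_. borel))"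
    if "R \<subseteq> K" for R K :: "nat set"
    by (intro measurable_compose[OF borel_measurable_sum[where f="\<lambda>i f. f i"]] measurable_component_singleton)
      (use that in auto)
  have P: "P j \<in> sets (PiM {..<j} (\<lambda>_. borel))" for j
    unfolding P_def
    by (intro sets.sets_Collect_conj sets.sets_Collect_finite_All borel_measurable_le borel_measurable_less part) auto
  have Q: "Q j \<in> sets (PiM {j..<n} (\<lambda>_. borel))" for j
    unfolding Q_def by (intro borel_measurable_le part) auto
  define E where "E j = {w \<in> space M. (\<forall>i\<in>{l..<j}. a \<le> norm (U i w)) \<and> norm (U j w) < a}" for j
  define H where "H j = {w \<in> space M. norm (U n w - U j w) \<le> b}" for j
  have E_sets: "E j \<in> events" if "j \<le> n" for j
    unfolding E_def using that
    by (intro sets.sets_Collect_conj sets.sets_Collect_finite_All borel_measurable_le borel_measurable_less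
        borel_measurable_norm[THEN measurable_compose[rotated]] U) auto
  have H_sets: "H j \<in> events" if "j \<le> n" for j
    unfolding H_def using that
    by (intro borel_measurable_le borel_measurable_norm[THEN measurable_compose[rotated]] borel_measurable_diff U) auto
  have half: "prob (E j) \<le> 2 * prob (E j \<inter> H j)" if j: "j \<in> {l..n}" for j
  proof -
    have "prob {w \<in> space M. (\<lambda>i\<in>{..<j}. D i w) \<in> P j \<and> (\<lambda>i\<in>{j..<n}. D i w) \<in> Q j}
        = prob {w \<in> space M. (\<lambda>i\<in>{..<j}. D i w) \<in> P j} * prob {w \<in> space M. (\<lambda>i\<in>{j..<n}. D i w) \<in> Q j}"
      using j by (intro prob_indep_var_conj[OF indep_var_restrict[OF ind]] P Q) auto
    moreover have "{w \<in> space M. (\<lambda>i\<in>{..<j}. D i w) \<in> P j} = E j"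
      by (auto simp: P_def E_def U_def space_PiM)
    moreover have "{w \<in> space M. (\<lambda>i\<in>{j..<n}. D i w) \<in> Q j} = H j"
    proof -
      have "U n w - U j w = (\<Sum>r\<in>{j..<n}. D r w)" for w
        using sum.atLeastLessThan_concat[of 0 j n "\<lambda>i. D i w"] j
        by (simp add: U_def lessThan_atLeast0 algebra_simps)
      then show ?thesis by (auto simp: Q_def H_def space_PiM)
    qed
    moreover have "{w \<in> space M. (\<lambda>i\<in>{..<j}. D i w) \<in> P j \<and> (\<lambda>i\<in>{j..<n}. D i w) \<in> Q j} =
        {w \<in> space M. (\<lambda>i\<in>{..<j}. D i w) \<in> P j} \<inter> {w \<in> space M. (\<lambda>i\<in>{j..<n}. D i w) \<in> Q j}"
      by blast
    ultimately have "prob (E j \<inter> H j) = prob (E j) * prob (H j)"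
      by simp
    moreover have "1 / 2 \<le> prob (H j)"
    proof -
      have "{w \<in> space M. b < norm (U n w - U j w)} = space M - H j"
        by (auto simp: H_def)
      then show ?thesis
        using tight[OF j] prob_compl[OF H_sets] j by auto
    qed
    then have "prob (E j) * (1 / 2) \<le> prob (E j) * prob (H j)"
      by (intro mult_left_mono) auto
    ultimately show ?thesis by simp
  qed
  have disj: "disjoint_family_on E {l..n}"
    unfolding disjoint_family_on_def
  proof (intro ballI impI)
    fix i j assume "i \<in> {l..n}" "j \<in> {l..n}" "i \<noteq> j"
    then show "E i \<inter> E j = {}"
      by (cases i j rule: linorder_cases) (force simp: E_def)+
  qed
  then have disj': "disjoint_family_on (\<lambda>j. E j \<inter> H j) {l..n}"
    unfolding disjoint_family_on_def by blast
  have "{w \<in> space M. \<exists>j\<in>{l..n}. norm (U j w) < a} \<subseteq> (\<Union>j\<in>{l..n}. E j)"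
  proof safe
    fix w j assume w: "w \<in> space M" and j: "j \<in> {l..n}" "norm (U j w) < a"
    define i where "i = (LEAST i. i \<in> {l..n} \<and> norm (U i w) < a)"
    have i: "i \<in> {l..n} \<and> norm (U i w) < a"
      unfolding i_def
      by (rule LeastI[where P="\<lambda>i. i \<in> {l..n} \<and> norm (U i w) < a" and k=j]) (use j in simp)
    have "a \<le> norm (U k w)" if "k \<in> {l..<i}" for k
    proof -
      have "\<not> (k \<in> {l..n} \<and> norm (U k w) < a)"
        using that unfolding i_def
        by (intro not_less_Least[where P="\<lambda>i. i \<in> {l..n} \<and> norm (U i w) < a"]) simp
      then show ?thesis using that i by auto
    qed
    then have "w \<in> E i"
      using i w by (auto simp: E_def)
    then show "w \<in> (\<Union>j\<in>{l..n}. E j)"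
      using i by blast
  qed
  then have "prob {w \<in> space M. \<exists>j\<in>{l..n}. norm (U j w) < a} \<le> prob (\<Union>j\<in>{l..n}. E j)"
    using E_sets by (intro finite_measure_mono sets.finite_UN) auto
  also have "\<dots> \<le> (\<Sum>j\<in>{l..n}. prob (E j))"
    using E_sets by (intro measure_UNION_le) auto
  also have "\<dots> \<le> (\<Sum>j\<in>{l..n}. 2 * prob (E j \<inter> H j))"
    by (intro sum_mono half)
  also have "\<dots> = 2 * prob (\<Union>j\<in>{l..n}. E j \<inter> H j)"
    using E_sets H_sets disj'
    by (subst finite_measure_finite_Union) (auto simp: sum_distrib_left)
  also have "\<dots> \<le> 2 * prob {w \<in> space M. norm (U n w) < a + b}"
  proof (intro mult_left_mono finite_measure_mono)
    show "(\<Union>j\<in>{l..n}. E j \<inter> H j) \<subseteq> {w \<in> space M. norm (U n w) < a + b}"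
    proof safe
      fix w j assume "w \<in> E j" "w \<in> H j"
      then show "norm (U n w) < a + b" "w \<in> space M"
        using norm_triangle_ineq[of "U j w" "U n w - U j w"] by (auto simp: E_def H_def)
    qed
    show "{w \<in> space M. norm (U n w) < a + b} \<in> events"
      by (intro borel_measurable_less borel_measurable_norm[THEN measurable_compose[rotated]] U) auto
  qed auto
  finally show ?thesis .
qed

context semi_levy_process
begin

lemma increment_measurable: "0 \<le> s \<Longrightarrow> 0 \<le> t \<Longrightarrow> (\<lambda>w. X t w - X s w) \<in> borel_measurable M"
  by (intro borel_measurable_diff random_variable)

lemma distr_increment_add_periods:
  assumes "0 \<le> s" "0 \<le> t"
  shows "distr M borel (\<lambda>w. X (t + real n * p) w - X (s + real n * p) w) = distr M borel (\<lambda>w. X t w - X s w)"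
proof (induction n)
  case (Suc n)
  have "0 \<le> real n * p" using period_pos by simp
  then show ?case
    using periodic_increments[of "s + real n * p" "t + real n * p"] Suc assms
    by (simp add: algebra_simps)
qed simp

text \<open>Cut at the times \<open>s \<le> n * p \<le> s + n * p\<close>. The last piece has the law of \<open>X s - X 0\<close> by periodicity, and both
  it and \<open>X s - X 0\<close> are independent of the middle piece; moving it to the front does not change the law of
  the sum.\<close>
lemma distr_skeleton_shift:
  assumes s: "0 \<le> s" "s \<le> real n * p"
  shows "distr M borel (\<lambda>w. X (s + real n * p) w - X s w) = distr M borel (\<lambda>w. X (real n * p) w - X 0 w)"
proof -
  let ?T = "real n * p"
  have "distr M borel (\<lambda>w. \<Sum>c\<in>UNIV. X (if c then ?T else s + ?T) w - X (if c then s else ?T) w)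
      = distr M borel (\<lambda>w. \<Sum>c\<in>UNIV. X (if c then ?T else s) w - X (if c then s else 0) w)"
  proof (rule distr_sum_cong)
    show "indep_vars (\<lambda>_. borel) (\<lambda>c w. X (if c then ?T else s + ?T) w - X (if c then s else ?T) w) UNIV"
      using s by (intro indep_vars_disjoint_increments) (auto simp: disjoint_family_on_def)
    show "indep_vars (\<lambda>_. borel) (\<lambda>c w. X (if c then ?T else s) w - X (if c then s else 0) w) UNIV"
      using s by (intro indep_vars_disjoint_increments) (auto simp: disjoint_family_on_def)
  qed (use distr_increment_add_periods[of 0 s n] s in auto)
  then show ?thesis
    by (simp add: UNIV_bool)
qed

text \<open>Stochastic continuity makes one bound work near each time \<open>r\<close>, and \<open>{0..p}\<close> is compact.\<close>
lemma increments_tight: "\<exists>b. \<forall>r\<in>{0..p}. prob {w \<in> space M. b < norm (X p w - X r w)} \<le> 1 / 2"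
proof -
  have "\<exists>d>0. \<exists>b. \<forall>s\<ge>0. dist s r < d \<longrightarrow> prob {w \<in> space M. b < norm (X p w - X s w)} \<le> 1 / 2"
    if r: "r \<in> {0..p}" for r
  proof -
    have "\<forall>\<^sub>F s in at r within {0..}. prob {w \<in> space M. norm (X s w - X r w) > 1} < 1 / 4"
      using stochastically_continuous[of r 1] r by (intro order_tendstoD) auto
    then obtain d where d: "0 < d" "\<And>s. 0 \<le> s \<Longrightarrow> s \<noteq> r \<Longrightarrow> dist s r < d \<Longrightarrow>
        prob {w \<in> space M. norm (X s w - X r w) > 1} < 1 / 4"
      unfolding eventually_at by (auto simp: Bex_def)
    obtain b where b: "prob {w \<in> space M. real b < norm (X p w - X r w)} < 1 / 4"
      using norm_tail_small[OF increment_measurable[of r p], of "1 / 4"] r period_pos by auto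
    have "prob {w \<in> space M. real b + 1 < norm (X p w - X s w)} \<le> 1 / 2" if s: "0 \<le> s" "dist s r < d" for s
    proof -
      have [measurable]: "X s \<in> borel_measurable M" "X r \<in> borel_measurable M" "X p \<in> borel_measurable M"
        using s r period_pos by (auto intro!: random_variable)
      have "prob {w \<in> space M. norm (X s w - X r w) > 1} < 1 / 4"
        using d(2)[OF s(1)] s(2) by (cases "s = r") auto
      moreover have "prob {w \<in> space M. real b + 1 < norm (X p w - X s w)}
          \<le> prob ({w \<in> space M. real b < norm (X p w - X r w)} \<union> {w \<in> space M. norm (X s w - X r w) > 1})"
      proof (rule finite_measure_mono)
        show "{w \<in> space M. real b + 1 < norm (X p w - X s w)}
            \<subseteq> {w \<in> space M. real b < norm (X p w - X r w)} \<union> {w \<in> space M. norm (X s w - X r w) > 1}"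
        proof safe
          fix w assume "real b + 1 < norm (X p w - X s w)" "\<not> 1 < norm (X s w - X r w)"
          then show "real b < norm (X p w - X r w)"
            using norm_triangle_ineq4[of "X p w - X r w" "X s w - X r w"] by simp
        qed
      qed measurable
      moreover have "\<dots> \<le> prob {w \<in> space M. real b < norm (X p w - X r w)} + prob {w \<in> space M. norm (X s w - X r w) > 1}"
        by (rule measure_Un_le) measurable
      ultimately show ?thesis using b by linarith
    qed
    then show ?thesis using d(1) by blast
  qed
  then have "\<forall>r. \<exists>db. r \<in> {0..p} \<longrightarrow> 0 < fst db \<and>
      (\<forall>s\<ge>0. dist s r < fst db \<longrightarrow> prob {w \<in> space M. snd db < norm (X p w - X s w)} \<le> 1 / 2)"
    by (simp del: atLeastAtMost_iff)
  from choice[OF this] obtain f where f: "\<And>r. r \<in> {0..p} \<Longrightarrow> 0 < fst (f r) \<and>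
      (\<forall>s\<ge>0. dist s r < fst (f r) \<longrightarrow> prob {w \<in> space M. snd (f r) < norm (X p w - X s w)} \<le> 1 / 2)"
    by blast
  define d b where "d r = fst (f r)" and "b r = snd (f r)" for r
  have d: "0 < d r" if "r \<in> {0..p}" for r
    using f[OF that] by (simp add: d_def)
  have b: "prob {w \<in> space M. b r < norm (X p w - X s w)} \<le> 1 / 2"
    if "r \<in> {0..p}" "0 \<le> s" "dist s r < d r" for r s
    using f[OF that(1)] that by (simp add: d_def b_def)
  have cover: "{0..p} \<subseteq> (\<Union>r\<in>{0..p}. ball r (d r))"
    using d by force
  obtain C where C: "C \<subseteq> {0..p}" "finite C" "{0..p} \<subseteq> (\<Union>r\<in>C. ball r (d r))"
    by (rule compactE_image[OF compact_Icc _ cover]) auto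
  have "prob {w \<in> space M. Max (b ` C) < norm (X p w - X s w)} \<le> 1 / 2" if s: "s \<in> {0..p}" for s
  proof -
    obtain r where r: "r \<in> C" "dist s r < d r"
      using C s by (force simp: dist_commute)
    have [measurable]: "X s \<in> borel_measurable M" "X p \<in> borel_measurable M"
      using s by (auto intro!: random_variable)
    have "b r \<le> Max (b ` C)" using r C by (intro Max_ge) auto
    then have "prob {w \<in> space M. Max (b ` C) < norm (X p w - X s w)} \<le> prob {w \<in> space M. b r < norm (X p w - X s w)}"
      by (intro finite_measure_mono) auto
    also have "\<dots> \<le> 1 / 2"
      using b[of r s] r C s by auto
    finally show ?thesis .
  qed
  then show ?thesis by blast
qed

text \<open>The bound is first proved for visits at the times of the \<open>m\<close>-th dyadic subdivision of the period, where
  it is \<open>first_entrance_bound\<close>. By right-continuity a visit to an open ball lasts for some time, so it is seen by a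
  fine enough subdivision. The event of a visit is only enclosed in a measurable set, which is all that
  Borel-Cantelli needs.\<close>
lemma prob_visit_in_period_le:
  assumes n: "0 < n"
    and b: "\<And>r. r \<in> {0..p} \<Longrightarrow> prob {w \<in> space M. b < norm (X p w - X r w)} \<le> 1 / 2"
  shows "\<exists>A\<in>events. {w \<in> space M. \<exists>t. real n * p \<le> t \<and> t < real (Suc n) * p \<and> norm (X t w - X 0 w) < a} \<subseteq> A \<and>
    prob A \<le> 2 * prob {w \<in> space M. norm (X (real (Suc n) * p) w - X 0 w) < a + b}"
proof -
  define g where "g m j = real n * p + real j * p / 2 ^ m" for m j :: nat
  have g_pos: "0 < g m j" for m j
    using n period_pos by (auto simp: g_def intro!: add_pos_nonneg)
  define A where "A m = {w \<in> space M. \<exists>j\<in>{..2 ^ m}. norm (X (g m j) w - X 0 w) < a}" for m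
  have A_sets: "A m \<in> events" for m
    unfolding A_def
    by (intro sets.sets_Collect_finite_Ex borel_measurable_less
        borel_measurable_norm[THEN measurable_compose[rotated]] increment_measurable)
      (use g_pos[of m] in \<open>auto intro: less_imp_le\<close>)
  have prob_A: "prob (A m) \<le> 2 * prob {w \<in> space M. norm (X (real (Suc n) * p) w - X 0 w) < a + b}" for m
  proof -
    (* Time \<open>0\<close> is put in front of the grid, so that the partial sums of increments are \<open>X (t j) - X 0\<close>; the
       visits counted have index at least \<open>1\<close>. The assumption \<open>0 < n\<close> keeps the sequence strictly increasing. *)
    define t where "t i = (case i of 0 \<Rightarrow> 0 | Suc j \<Rightarrow> g m j)" for i
    let ?k = "Suc (2 ^ m)"
    have t_mono: "t i < t (Suc i)" for i
    proof (cases i)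
      case 0
      then show ?thesis using g_pos[of m 0] by (simp add: t_def)
    next
      case (Suc j)
      then show ?thesis using period_pos by (simp add: t_def g_def field_simps)
    qed
    have sum: "(\<Sum>i<j. X (t (Suc i)) w - X (t i) w) = X (t j) w - X 0 w" for j w
      by (subst sum_lessThan_telescope) (simp add: t_def)
    have t_end: "t ?k = real (Suc n) * p"
      by (simp add: t_def g_def algebra_simps)
    have "prob {w \<in> space M. \<exists>j\<in>{1..?k}. norm (\<Sum>i<j. X (t (Suc i)) w - X (t i) w) < a}
        \<le> 2 * prob {w \<in> space M. norm (\<Sum>i<?k. X (t (Suc i)) w - X (t i) w) < a + b}"
    proof (rule first_entrance_bound)
      show "indep_vars (\<lambda>_. borel) (\<lambda>i w. X (t (Suc i)) w - X (t i) w) {..<?k}"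
        using t_mono by (intro independent_increments) (auto simp: t_def)
      fix j assume j: "j \<in> {1..?k}"
      then obtain i where i: "j = Suc i" "i \<le> 2 ^ m"
        by (cases j) auto
      define r where "r = real i * p / 2 ^ m"
      have "real i \<le> 2 ^ m" using i by (metis of_nat_le_iff of_nat_numeral of_nat_power)
      then have r: "r \<in> {0..p}"
        using period_pos by (auto simp: r_def field_simps)
      have "t j = r + real n * p" "t ?k = p + real n * p"
        using i by (auto simp: t_def g_def r_def algebra_simps)
      then have "distr M borel (\<lambda>w. X (t ?k) w - X (t j) w) = distr M borel (\<lambda>w. X p w - X r w)"
        using distr_increment_add_periods[of r p n] r by simp
      then have "prob {w \<in> space M. X (t ?k) w - X (t j) w \<in> {x. b < norm x}}
          = prob {w \<in> space M. X p w - X r w \<in> {x. b < norm x}}"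
        using g_pos[of m] r i period_pos
        by (intro prob_eq_of_distr_eq) (auto simp: t_def intro!: increment_measurable intro: less_imp_le)
      then show "prob {w \<in> space M. b < norm ((\<Sum>i<?k. X (t (Suc i)) w - X (t i) w) - (\<Sum>i<j. X (t (Suc i)) w - X (t i) w))} \<le> 1 / 2"
        unfolding sum using b[OF r] by simp
    qed
    moreover have "A m = {w \<in> space M. \<exists>j\<in>{1..?k}. norm (\<Sum>i<j. X (t (Suc i)) w - X (t i) w) < a}"
    proof -
      have "{1..?k} = Suc ` {..2 ^ m}"
        unfolding image_Suc_atMost by simp
      then show ?thesis
        unfolding sum A_def by (simp add: t_def)
    qed
    ultimately show ?thesis
      unfolding sum t_end by simp
  qed
  have inc: "incseq A"
  proof (rule incseq_SucI, safe)
    fix m w assume "w \<in> A m"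
    then obtain j where j: "w \<in> space M" "j \<le> 2 ^ m" "norm (X (g m j) w - X 0 w) < a"
      by (auto simp: A_def)
    moreover have "g (Suc m) (2 * j) = g m j" "2 * j \<le> 2 ^ Suc m"
      using j(2) by (auto simp: g_def)
    ultimately show "w \<in> A (Suc m)"
      unfolding A_def by (metis (mono_tags, lifting) mem_Collect_eq atMost_iff)
  qed
  have "(\<lambda>m. prob (A m)) \<longlonglongrightarrow> prob (\<Union>m. A m)"
    using A_sets inc by (intro finite_Lim_measure_incseq) auto
  then have "prob (\<Union>m. A m) \<le> 2 * prob {w \<in> space M. norm (X (real (Suc n) * p) w - X 0 w) < a + b}"
    using prob_A by (intro LIMSEQ_le_const2) auto
  moreover have "{w \<in> space M. \<exists>t. real n * p \<le> t \<and> t < real (Suc n) * p \<and> norm (X t w - X 0 w) < a} \<subseteq> (\<Union>m. A m)"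
  proof safe
    fix w t assume w: "w \<in> space M" and t: "real n * p \<le> t" "t < real (Suc n) * p" "norm (X t w - X 0 w) < a"
    have t0: "0 \<le> t"
      using t(1) period_pos by (meson mult_nonneg_nonneg of_nat_0_le_iff less_imp_le order_trans)
    have "((\<lambda>s. norm (X s w - X 0 w)) \<longlongrightarrow> norm (X t w - X 0 w)) (at_right t)"
      by (intro tendsto_intros right_continuous w t0)
    then have "\<forall>\<^sub>F s in at_right t. norm (X s w - X 0 w) < a"
      using t(3) by (rule order_tendstoD)
    then obtain d where d: "t < d" "\<And>s. t < s \<Longrightarrow> s < d \<Longrightarrow> norm (X s w - X 0 w) < a"
      unfolding eventually_at_right_field by blast
    define h where "h = min d (real (Suc n) * p) - t"
    have h: "0 < h" using d t by (simp add: h_def)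
    obtain m where "p / h < 2 ^ m"
      using real_arch_pow[of 2 "p / h"] by auto
    then have m: "p / 2 ^ m < h" using h by (simp add: field_simps)
    (* The first grid point strictly after \<open>t\<close>; it is at most one mesh width away. *)
    define j where "j = Suc (nat \<lfloor>(t - real n * p) / (p / 2 ^ m)\<rfloor>)"
    have u: "0 \<le> (t - real n * p) / (p / 2 ^ m)"
      using t period_pos by simp
    then have "real j - 1 \<le> (t - real n * p) / (p / 2 ^ m)" "(t - real n * p) / (p / 2 ^ m) < real j"
      unfolding j_def by linarith+
    moreover have "0 < p / 2 ^ m"
      using period_pos by simp
    ultimately have "(real j - 1) * (p / 2 ^ m) \<le> t - real n * p" "t - real n * p < real j * (p / 2 ^ m)"
      by (simp_all only: pos_le_divide_eq pos_divide_less_eq)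
    then have j: "t < g m j" "g m j \<le> t + p / 2 ^ m"
      by (simp_all add: g_def left_diff_distrib diff_divide_distrib)
    then have "g m j < d" "g m j < real (Suc n) * p"
      using m by (auto simp: h_def)
    then have "real j * p / 2 ^ m < p" by (simp add: g_def algebra_simps)
    then have "real j < 2 ^ m" using period_pos by (simp add: field_simps)
    then have "j \<le> 2 ^ m" by (metis less_imp_le of_nat_le_iff of_nat_numeral of_nat_power)
    then have "w \<in> A m"
      using d(2)[of "g m j"] j \<open>g m j < d\<close> w by (auto simp: A_def)
    then show "w \<in> (\<Union>m. A m)" by blast
  qed
  ultimately show ?thesis
    using A_sets by blast
qed

theorem recurrent_iff_skeleton_not_summable:
  "recurrent_process M X \<longleftrightarrow> (\<exists>c. \<not> summable (\<lambda>n. prob {w \<in> space M. norm (X (real n * p) w - X 0 w) < c}))"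
proof
  assume rec: "recurrent_process M X"
  obtain b where b: "\<And>r. r \<in> {0..p} \<Longrightarrow> prob {w \<in> space M. b < norm (X p w - X r w)} \<le> 1 / 2"
    using increments_tight by blast
  (* Visits to the unit ball are compared with the ball of radius \<open>1 + b\<close> at the end of the period. *)
  let ?q = "\<lambda>n. prob {w \<in> space M. norm (X (real n * p) w - X 0 w) < 1 + b}"
  have "\<not> summable ?q"
  proof
    assume "summable ?q"
    then have "summable (\<lambda>n. ?q (Suc (Suc n)))"
      using summable_Suc_iff[of ?q] summable_Suc_iff[of "\<lambda>n. ?q (Suc n)"] by blast
    (* Period \<open>Suc n\<close> ends at time \<open>Suc (Suc n) * p\<close>; period \<open>0\<close> is left out, as it does not affect recurrence. *)
    then have sm: "summable (\<lambda>n. 2 * ?q (Suc (Suc n)))"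
      by (rule summable_mult)
    let ?V = "\<lambda>n. {w \<in> space M. \<exists>t. real n * p \<le> t \<and> t < real (Suc n) * p \<and> norm (X t w - X 0 w) < 1}"
    have "\<forall>n. \<exists>A. A \<in> events \<and> ?V (Suc n) \<subseteq> A \<and> prob A \<le> 2 * ?q (Suc (Suc n))"
    proof
      show "\<exists>A. A \<in> events \<and> ?V (Suc n) \<subseteq> A \<and> prob A \<le> 2 * ?q (Suc (Suc n))" for n
        using prob_visit_in_period_le[OF zero_less_Suc b, of n 1] unfolding Bex_def .
    qed
    from choice[OF this] obtain A where A: "\<And>n. A n \<in> events"
      "\<And>n. ?V (Suc n) \<subseteq> A n" "\<And>n. prob (A n) \<le> 2 * ?q (Suc (Suc n))"
      by blast
    have "summable (\<lambda>n. prob (A n))"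
      by (rule summable_comparison_test'[OF sm, of 0]) (use A in auto)
    then have ev: "AE w in M. \<forall>\<^sub>F n in sequentially. w \<in> space M - A n"
      using A by (intro borel_cantelli_AE1) (auto simp: emeasure_eq_measure)
    have lim: "AE w in M. Liminf at_top (\<lambda>t. ereal (norm (X t w - X 0 w))) = 0"
      using rec by (auto simp: recurrent_process_def)
    have "AE w in M. False"
      using ev lim
    proof eventually_elim
      case (elim w)
      then obtain N where N: "\<And>n. N \<le> n \<Longrightarrow> w \<in> space M - A n"
        by (auto simp: eventually_sequentially)
      have "\<forall>\<^sub>F t in at_top. 1 \<le> ereal (norm (X t w - X 0 w))"
        using eventually_ge_at_top[of "real (Suc N) * p"]
      proof eventually_elim
        case (elim t)
        define n where "n = nat \<lfloor>t / p\<rfloor>"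
        have "real (Suc N) \<le> t / p" using elim period_pos by (simp add: field_simps)
        then have n: "Suc N \<le> n" "real n \<le> t / p" "t / p < real (Suc n)"
          unfolding n_def by linarith+
        then obtain k where k: "n = Suc k" "N \<le> k" by (cases n) auto
        have "real (Suc k) * p \<le> t" "t < real (Suc (Suc k)) * p"
          using n k period_pos by (auto simp: field_simps)
        then have "\<not> norm (X t w - X 0 w) < 1"
          using A(2)[of k] N[OF k(2)] by auto
        then show ?case by (simp add: one_ereal_def)
      qed
      then have "1 \<le> Liminf at_top (\<lambda>t. ereal (norm (X t w - X 0 w)))"
        by (rule Liminf_bounded)
      then show False using elim by simp
    qed
    then show False by simp
  qed
  then show "\<exists>c. \<not> summable (\<lambda>n. prob {w \<in> space M. norm (X (real n * p) w - X 0 w) < c})"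
    by blast
next
  assume "\<exists>c. \<not> summable (\<lambda>n. prob {w \<in> space M. norm (X (real n * p) w - X 0 w) < c})"
  then obtain c where c: "\<not> summable (\<lambda>n. prob {w \<in> space M. norm (X (real n * p) w - X 0 w) < c})"
    by blast
  show "recurrent_process M X"
    unfolding recurrent_process_def
  proof (intro allI impI)
    fix s :: real assume s: "0 \<le> s"
    let ?t = "\<lambda>i. s + real i * p"
    have t0: "0 \<le> ?t i" for i
      using s period_pos by simp
    have sum: "(\<Sum>i<n. X (?t (Suc i)) w - X (?t i) w) = X (?t n) w - X s w" for n w
      by (subst sum_lessThan_telescope) simp
    have div: "\<not> summable (\<lambda>n. prob {w \<in> space M. norm (X (?t n) w - X s w) < c})"
    proof -
      obtain N where N: "s < real N * p"
        using reals_Archimedean3[OF period_pos] by blast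
      have "\<forall>\<^sub>F n in sequentially. prob {w \<in> space M. norm (X (?t n) w - X s w) < c}
          = prob {w \<in> space M. norm (X (real n * p) w - X 0 w) < c}"
        using eventually_ge_at_top[of N]
      proof eventually_elim
        case (elim n)
        have "real N * p \<le> real n * p" using elim period_pos by simp
        then have "s \<le> real n * p" using N by simp
        from distr_skeleton_shift[OF s this]
        have "prob {w \<in> space M. X (?t n) w - X s w \<in> {x. norm x < c}}
            = prob {w \<in> space M. X (real n * p) w - X 0 w \<in> {x. norm x < c}}"
          using t0 s period_pos by (intro prob_eq_of_distr_eq) (auto intro!: increment_measurable)
        then show ?case by simp
      qed
      from summable_cong[OF this] show ?thesis using c by simp
    qed
    have "AE w in M. \<exists>\<^sub>F n in sequentially. norm (\<Sum>i<n. X (?t (Suc i)) w - X (?t i) w) < \<epsilon>"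
      if "0 < \<epsilon>" for \<epsilon>
    proof (rule random_walk_returns[OF _ _ _ that])
      show "\<not> summable (\<lambda>n. prob {w \<in> space M. norm (\<Sum>i<n. X (?t (Suc i)) w - X (?t i) w) < c})"
        unfolding sum by (rule div)
      show "indep_vars (\<lambda>_. borel) (\<lambda>i w. X (?t (Suc i)) w - X (?t i) w) {..<n}" for n
        using s period_pos by (intro independent_increments) auto
      show "distr M borel (\<lambda>w. X (?t (Suc i)) w - X (?t i) w) = distr M borel (\<lambda>w. X (?t (Suc 0)) w - X (?t 0) w)" for i
        using distr_increment_add_periods[of s "s + p" i] s period_pos
        by (simp add: algebra_simps)
    qed
    then have "AE w in M. \<forall>k. \<exists>\<^sub>F n in sequentially. norm (X (?t n) w - X s w) < inverse (real (Suc k))"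
      unfolding sum by (subst AE_all_countable) simp
    then show "AE w in M. Liminf at_top (\<lambda>t. ereal (norm (X t w - X s w))) = 0"
    proof eventually_elim
      case (elim w)
      let ?L = "Liminf at_top (\<lambda>t. ereal (norm (X t w - X s w)))"
      have "0 \<le> ?L"
        by (intro Liminf_bounded) auto
      (* A positive lower limit would keep the walk \<open>X (s + n * p) - X s\<close> away from \<open>0\<close>. *)
      moreover have "\<not> 0 < ?L"
      proof
        assume "0 < ?L"
        then obtain e where e: "0 < ereal e" "ereal e < ?L"
          using ereal_dense2 by blast
        then obtain k where k: "inverse (real (Suc k)) < e"
          using reals_Archimedean by auto
        have "\<forall>\<^sub>F t in at_top. ereal e < ereal (norm (X t w - X s w))"
          using e(2) by (rule less_LiminfD)
        moreover have "filterlim ?t at_top sequentially"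
          using period_pos
          by (intro filterlim_tendsto_add_at_top[OF tendsto_const] filterlim_at_top_mult_tendsto_pos[OF tendsto_const]
              filterlim_real_sequentially)
        ultimately have "\<forall>\<^sub>F n in sequentially. e < norm (X (?t n) w - X s w)"
          by (auto dest!: eventually_compose_filterlim)
        then have "\<forall>\<^sub>F n in sequentially. \<not> norm (X (?t n) w - X s w) < inverse (real (Suc k))"
          by eventually_elim (use k in simp)
        then show False
          using elim by (simp only: frequently_def)
      qed
      ultimately show ?case by (meson antisym not_less)
    qed
  qed
qed

end

section \<open>Increments of two independent Levy processes\<close>

locale independent_levy_pair = prob_space M + Y: levy_process M Y + Z: levy_process M Z
  for M :: "'w measure" and Y Z :: "real \<Rightarrow> 'w \<Rightarrow> 'a::euclidean_space" +
  assumes independent: "independent_processes M Y Z"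
begin

text \<open>A single family indexed by the truth values, so that increments of \<open>Y\<close> and of \<open>Z\<close> can be treated as one
  family whose index tells which process is meant.\<close>
definition driver :: "bool \<Rightarrow> real \<Rightarrow> 'w \<Rightarrow> 'a" where
  "driver c = (if c then Y else Z)"

lemma levy_driver: "levy_process M (driver c)"
  using Y.levy_process_axioms Z.levy_process_axioms by (simp add: driver_def)

lemma additive_driver: "additive_process M (driver c)"
  using levy_driver by (simp add: levy_process_def)

lemma driver_measurable: "0 \<le> t \<Longrightarrow> driver c t \<in> borel_measurable M"
  using additive_process.random_variable[OF additive_driver] .

text \<open>The intervals used for \<open>Y\<close> may overlap those used for \<open>Z\<close>: the two processes are independent, so
  disjointness is only required among increments of the same process.\<close>
lemma indep_vars_driver_increments:
  assumes J: "finite J" and ab: "\<And>j. j \<in> J \<Longrightarrow> 0 \<le> a j \<and> a j \<le> b j"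
    and disj: "\<And>c. disjoint_family_on (\<lambda>j. {a j<..b j}) {j \<in> J. \<phi> j = c}"
  shows "indep_vars (\<lambda>_. borel) (\<lambda>j w. driver (\<phi> j) (b j) w - driver (\<phi> j) (a j) w) J"
proof -
  define V where "V j w = driver (\<phi> j) (b j) w - driver (\<phi> j) (a j) w" for j w
  define K where "K c = {j \<in> J. \<phi> j = c}" for c
  define inc where "inc c f = (\<lambda>j\<in>K c. f (b j) - f (a j))" for c and f :: "real \<Rightarrow> 'a"
  have within: "indep_vars (\<lambda>_. borel) V (K c)" for c
  proof -
    have "indep_vars (\<lambda>_. borel) (\<lambda>j w. driver c (b j) w - driver c (a j) w) (K c)"
      unfolding K_def
      by (intro additive_process.indep_vars_disjoint_increments[OF additive_driver] disj) (use J ab in auto)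
    then show ?thesis
      by (rule indep_vars_cong[THEN iffD1, rotated -1]) (auto simp: K_def V_def)
  qed
  have inc: "inc c \<in> measurable (PiM {0..} (\<lambda>_. borel)) (PiM (K c) (\<lambda>_. borel))" for c
    unfolding inc_def
    by (intro measurable_restrict borel_measurable_diff measurable_component_singleton)
       (use ab in \<open>auto simp: K_def intro: order_trans\<close>)
  have "indep_var (PiM (K True) (\<lambda>_. borel)) (inc True \<circ> (\<lambda>w. \<lambda>t\<in>{0..}. Y t w))
      (PiM (K False) (\<lambda>_. borel)) (inc False \<circ> (\<lambda>w. \<lambda>t\<in>{0..}. Z t w))"
    using independent unfolding independent_processes_def by (rule indep_var_compose[OF _ inc inc])
  also have "inc True \<circ> (\<lambda>w. \<lambda>t\<in>{0..}. Y t w) = (\<lambda>w. \<lambda>j\<in>K True. V j w)"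
    using ab by (fastforce simp: inc_def V_def K_def driver_def fun_eq_iff restrict_def)
  also have "inc False \<circ> (\<lambda>w. \<lambda>t\<in>{0..}. Z t w) = (\<lambda>w. \<lambda>j\<in>K False. V j w)"
    using ab by (fastforce simp: inc_def V_def K_def driver_def fun_eq_iff restrict_def)
  finally have across: "indep_var (PiM (K True) (\<lambda>_. borel)) (\<lambda>w. \<lambda>j\<in>K True. V j w)
      (PiM (K False) (\<lambda>_. borel)) (\<lambda>w. \<lambda>j\<in>K False. V j w)" .
  have "indep_vars (\<lambda>_. borel) V (K True \<union> K False)"
    by (rule indep_vars_Un[OF within within _ across]) (auto simp: K_def)
  moreover have "K True \<union> K False = J"
    by (auto simp: K_def)
  ultimately show ?thesis
    by (simp add: V_def[abs_def])
qed

text \<open>By stationarity each increment has the law of the increment over \<open>(0, h]\<close>, where \<open>h\<close> is the length of its interval.\<close>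
lemma distr_sum_driver_increments_cong:
  assumes J: "finite J"
    and ab: "\<And>j. j \<in> J \<Longrightarrow> 0 \<le> a j \<and> a j \<le> b j"
      "\<And>c. disjoint_family_on (\<lambda>j. {a j<..b j}) {j \<in> J. \<phi> j = c}"
    and ab': "\<And>j. j \<in> J \<Longrightarrow> 0 \<le> a' j \<and> a' j \<le> b' j"
      "\<And>c. disjoint_family_on (\<lambda>j. {a' j<..b' j}) {j \<in> J. \<phi> j = c}"
    and length: "\<And>j. j \<in> J \<Longrightarrow> b j - a j = b' j - a' j"
  shows "distr M borel (\<lambda>w. \<Sum>j\<in>J. driver (\<phi> j) (b j) w - driver (\<phi> j) (a j) w)
       = distr M borel (\<lambda>w. \<Sum>j\<in>J. driver (\<phi> j) (b' j) w - driver (\<phi> j) (a' j) w)"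
proof (rule distr_sum_cong)
  fix j assume j: "j \<in> J"
  have "distr M borel (\<lambda>w. driver c (a + h) w - driver c a w) = distr M borel (\<lambda>w. driver c h w - driver c 0 w)"
    if "0 \<le> a" "0 \<le> h" for a h c
    using levy_process.stationary_increments[OF levy_driver, of 0 h a c] that by (simp add: add.commute)
  note shift = this
  define h where "h = b j - a j"
  have h: "0 \<le> h" "b j = a j + h" "b' j = a' j + h"
    using ab(1)[OF j] length[OF j] by (auto simp: h_def)
  show "distr M borel (\<lambda>w. driver (\<phi> j) (b j) w - driver (\<phi> j) (a j) w)
      = distr M borel (\<lambda>w. driver (\<phi> j) (b' j) w - driver (\<phi> j) (a' j) w)"
    unfolding h(2,3) using shift[of "a j" h "\<phi> j"] shift[of "a' j" h "\<phi> j"] ab(1)[OF j] ab'(1)[OF j] h(1) by simp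
qed (intro indep_vars_driver_increments assms; assumption)+

end

section \<open>Additive processes driven by two independent Levy processes\<close>

text \<open>\<open>V\<close> runs copies of \<open>Y\<close> and \<open>Z\<close> along clocks; \<open>\<phi> j\<close> tells which process the \<open>j\<close>-th clock drives. The
  number of clocks needed may grow with the time horizon \<open>T\<close>.\<close>
locale superposition = independent_levy_pair M Y Z
  for M :: "'w measure" and Y Z :: "real \<Rightarrow> 'w \<Rightarrow> 'a::euclidean_space" +
  fixes \<phi> :: "'j \<Rightarrow> bool" and clock :: "'j \<Rightarrow> real \<Rightarrow> real" and V :: "real \<Rightarrow> 'w \<Rightarrow> 'a"
  assumes clock_mono: "\<And>j. mono (clock j)"
    and clock_cont: "\<And>j t. isCont (clock j) t"
    and clock_nonneg: "\<And>j. 0 \<le> clock j 0"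
    and clock_disjoint: "\<And>i j T. 0 \<le> T \<Longrightarrow> i \<noteq> j \<Longrightarrow> \<phi> i = \<phi> j \<Longrightarrow>
        {clock i 0<..clock i T} \<inter> {clock j 0<..clock j T} = {}"
    and V_start_measurable: "V 0 \<in> borel_measurable M"
    and V_start: "AE w in M. V 0 w = 0"
    and V_sum: "\<And>T. \<exists>J. finite J \<and> (\<forall>t w. 0 \<le> t \<longrightarrow> t \<le> T \<longrightarrow> w \<in> space M \<longrightarrow>
        V t w = V 0 w + (\<Sum>j\<in>J. driver (\<phi> j) (clock j t) w - driver (\<phi> j) (clock j 0) w))"
begin

lemma clock_ge0: "0 \<le> t \<Longrightarrow> 0 \<le> clock j t"
  using clock_nonneg[of j] monoD[OF clock_mono[of j], of 0 t] by linarith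

text \<open>Time intervals that are disjoint are sent by one clock to disjoint intervals, by monotonicity; two clocks of
  the same process have disjoint ranges. So \<open>indep_vars_driver_increments\<close> applies to the increments of all
  summands over all intervals at once.\<close>
lemma clock_pieces_disjoint:
  assumes s_t: "\<And>i. i \<in> I \<Longrightarrow> 0 \<le> s i \<and> s i \<le> t i"
    and disj: "disjoint_family_on (\<lambda>i. {s i<..t i}) I"
  shows "disjoint_family_on (\<lambda>x. {clock (fst x) (s (snd x))<..clock (fst x) (t (snd x))})
    {x \<in> J \<times> I. \<phi> (fst x) = c}"
  unfolding disjoint_family_on_def
proof (intro ballI impI, rule ccontr)
  fix x y
  assume x: "x \<in> {x \<in> J \<times> I. \<phi> (fst x) = c}" and y: "y \<in> {x \<in> J \<times> I. \<phi> (fst x) = c}" and "x \<noteq> y"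
    and meet: "{clock (fst x) (s (snd x))<..clock (fst x) (t (snd x))} \<inter>
      {clock (fst y) (s (snd y))<..clock (fst y) (t (snd y))} \<noteq> {}"
  obtain j i where ji: "x = (j, i)" by (cases x)
  obtain k l where kl: "y = (k, l)" by (cases y)
  have mem: "i \<in> I" "l \<in> I" "\<phi> j = \<phi> k"
    using x y by (simp_all add: ji kl)
  from meet obtain u where "u \<in> {clock j (s i)<..clock j (t i)} \<inter> {clock k (s l)<..clock k (t l)}"
    unfolding ji kl fst_conv snd_conv by blast
  then have u: "clock j (s i) < u" "u \<le> clock j (t i)" "clock k (s l) < u" "u \<le> clock k (t l)"
    by simp_all
  show False
  proof (cases "j = k")
    case True
    then have "i \<noteq> l" using \<open>x \<noteq> y\<close> ji kl by simp
    then have "{s i<..t i} \<inter> {s l<..t l} = {}"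
      using disj mem unfolding disjoint_family_on_def by blast
    moreover have "s a < t b" if "clock k (s a) < u" "u \<le> clock k (t b)" for a b
      using monoD[OF clock_mono[of k], of "t b" "s a"] that by (cases "s a < t b") auto
    then have "s i < t l" "s l < t i" "s i < t i" "s l < t l"
      using u True by blast+
    then have "min (t i) (t l) \<in> {s i<..t i} \<inter> {s l<..t l}"
      by (simp add: min_def)
    ultimately show False by blast
  next
    case False
    define T where "T = max (t i) (t l)"
    have T: "0 \<le> T" using s_t[OF mem(1)] by (auto simp: T_def le_max_iff_disj)
    have "clock j 0 \<le> clock j (s i)" "clock j (t i) \<le> clock j T"
        "clock k 0 \<le> clock k (s l)" "clock k (t l) \<le> clock k T"
      using s_t[OF mem(1)] s_t[OF mem(2)] by (auto intro!: monoD[OF clock_mono] simp: T_def)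
    then have "u \<in> {clock j 0<..clock j T} \<inter> {clock k 0<..clock k T}"
      using u by simp
    then show False
      using clock_disjoint[OF T False mem(3)] by blast
  qed
qed

lemma V_increments:
  "\<exists>J. finite J \<and> (\<forall>s t w. 0 \<le> s \<longrightarrow> s \<le> T \<longrightarrow> 0 \<le> t \<longrightarrow> t \<le> T \<longrightarrow> w \<in> space M \<longrightarrow>
    V t w - V s w = (\<Sum>j\<in>J. driver (\<phi> j) (clock j t) w - driver (\<phi> j) (clock j s) w))"
proof -
  obtain J where J: "finite J" "\<And>t w. 0 \<le> t \<Longrightarrow> t \<le> T \<Longrightarrow> w \<in> space M \<Longrightarrow>
      V t w = V 0 w + (\<Sum>j\<in>J. driver (\<phi> j) (clock j t) w - driver (\<phi> j) (clock j 0) w)"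
    using V_sum[of T] by blast
  have "V t w - V s w = (\<Sum>j\<in>J. driver (\<phi> j) (clock j t) w - driver (\<phi> j) (clock j s) w)"
    if "0 \<le> s" "s \<le> T" "0 \<le> t" "t \<le> T" "w \<in> space M" for s t w
    using J(2)[of s w] J(2)[of t w] that by (simp add: sum_subtractf)
  then show ?thesis using J(1) by blast
qed

lemma V_measurable:
  assumes t: "0 \<le> t"
  shows "V t \<in> borel_measurable M"
proof -
  obtain J where J: "finite J" "\<And>w. w \<in> space M \<Longrightarrow>
      V t w = V 0 w + (\<Sum>j\<in>J. driver (\<phi> j) (clock j t) w - driver (\<phi> j) (clock j 0) w)"
    using V_sum[of t] t by blast
  have "(\<lambda>w. V 0 w + (\<Sum>j\<in>J. driver (\<phi> j) (clock j t) w - driver (\<phi> j) (clock j 0) w)) \<in> borel_measurable M"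
    by (intro borel_measurable_add borel_measurable_sum borel_measurable_diff driver_measurable
        V_start_measurable clock_ge0) (use t in auto)
  then show ?thesis
    using J(2) by (subst measurable_cong)
qed

lemma V_stochastically_continuous:
  assumes t: "0 \<le> t" and e: "0 < e"
  shows "((\<lambda>s. prob {w \<in> space M. norm (V s w - V t w) > e}) \<longlongrightarrow> 0) (at t within {0..})"
proof -
  obtain J where J: "finite J" "\<And>s w. 0 \<le> s \<Longrightarrow> s \<le> t + 1 \<Longrightarrow> w \<in> space M \<Longrightarrow>
      V s w - V t w = (\<Sum>j\<in>J. driver (\<phi> j) (clock j s) w - driver (\<phi> j) (clock j t) w)"
    using V_increments[of "t + 1"] t by force
  (* If a sum over \<open>J\<close> exceeds \<open>e\<close>, some summand exceeds \<open>e'\<close>. The \<open>+ 1\<close> covers the case of an empty \<open>J\<close>. *)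
  define e' where "e' = e / (real (card J) + 1)"
  have e': "0 < e'" using e by (simp add: e'_def)
  let ?far = "\<lambda>j u. {w \<in> space M. norm (driver (\<phi> j) u w - driver (\<phi> j) (clock j t) w) > e'}"
  have far_sets: "?far j u \<in> events" if "0 \<le> u" for j u
    by (intro borel_measurable_less borel_measurable_norm[THEN measurable_compose[rotated]]
        borel_measurable_diff driver_measurable clock_ge0) (use that t in auto)
  have "((\<lambda>s. prob (?far j (clock j s))) \<longlongrightarrow> prob (?far j (clock j t))) (at t within {0..})" for j
  proof (rule continuous_within_tendsto_compose[where S="{0..}" and f="\<lambda>u. prob (?far j u)"])
    show "continuous (at (clock j t) within {0..}) (\<lambda>u. prob (?far j u))"
      unfolding continuous_within
      using additive_process.stochastically_continuous[OF additive_driver, of "clock j t" e' "\<phi> j"]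
        clock_ge0[OF t] e' by simp
    show "\<forall>\<^sub>F s in at t within {0..}. clock j s \<in> {0..}"
      unfolding eventually_at_filter by (auto intro: clock_ge0 always_eventually)
    show "(clock j \<longlongrightarrow> clock j t) (at t within {0..})"
      using clock_cont[of t j] unfolding isCont_def by (rule tendsto_within_subset) simp
  qed
  moreover have "prob (?far j (clock j t)) = 0" for j
    using e' by simp
  ultimately have "((\<lambda>s. \<Sum>j\<in>J. prob (?far j (clock j s))) \<longlongrightarrow> (\<Sum>j\<in>J. 0)) (at t within {0..})"
    by (intro tendsto_sum) simp
  then have lim: "((\<lambda>s. \<Sum>j\<in>J. prob (?far j (clock j s))) \<longlongrightarrow> 0) (at t within {0..})"
    by simp
  have "\<forall>\<^sub>F s in at t within {0..}. 0 \<le> s \<and> s \<le> t + 1"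
    unfolding eventually_at by (intro exI[of _ 1]) (auto simp: dist_real_def)
  then have "\<forall>\<^sub>F s in at t within {0..}. prob {w \<in> space M. norm (V s w - V t w) > e} \<le> (\<Sum>j\<in>J. prob (?far j (clock j s)))"
  proof eventually_elim
    case (elim s)
    have "prob {w \<in> space M. norm (V s w - V t w) > e} \<le> prob (\<Union>j\<in>J. ?far j (clock j s))"
    proof (rule finite_measure_mono)
      show "(\<Union>j\<in>J. ?far j (clock j s)) \<in> events"
        using J far_sets clock_ge0 elim by (intro sets.finite_UN) auto
      show "{w \<in> space M. norm (V s w - V t w) > e} \<subseteq> (\<Union>j\<in>J. ?far j (clock j s))"
      proof (rule subsetI, rule ccontr)
        fix w assume w: "w \<in> {w \<in> space M. norm (V s w - V t w) > e}" and "w \<notin> (\<Union>j\<in>J. ?far j (clock j s))"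
        then have near: "norm (driver (\<phi> j) (clock j s) w - driver (\<phi> j) (clock j t) w) \<le> e'" if "j \<in> J" for j
          using that by (auto simp: not_less)
        have "norm (V s w - V t w) \<le> real (card J) * e'"
          using J(2)[of s w] w elim near by (auto intro: sum_norm_bound)
        also have "\<dots> \<le> e"
          using e by (simp add: e'_def field_simps)
        finally show False using w by simp
      qed
    qed
    also have "\<dots> \<le> (\<Sum>j\<in>J. prob (?far j (clock j s)))"
      using J far_sets clock_ge0 elim by (intro measure_UNION_le) auto
    finally show ?case .
  qed
  then show ?thesis
    by (intro tendsto_sandwich[OF _ _ tendsto_const lim]) auto
qed

lemma V_right_continuous:
  assumes w: "w \<in> space M" and t: "0 \<le> t"
  shows "((\<lambda>s. V s w) \<longlongrightarrow> V t w) (at_right t)"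
proof -
  obtain J where J: "finite J" "\<And>s. 0 \<le> s \<Longrightarrow> s \<le> t + 1 \<Longrightarrow>
      V s w = V 0 w + (\<Sum>j\<in>J. driver (\<phi> j) (clock j s) w - driver (\<phi> j) (clock j 0) w)"
    using V_sum[of "t + 1"] w by blast
  have "((\<lambda>s. driver (\<phi> j) (clock j s) w) \<longlongrightarrow> driver (\<phi> j) (clock j t) w) (at_right t)" for j
  proof (rule continuous_within_tendsto_compose[where S="{clock j t..}" and f="\<lambda>u. driver (\<phi> j) u w"])
    have "at (clock j t) within {clock j t..} = at_right (clock j t)"
      by (simp add: at_within_def) (rule arg_cong[where f="\<lambda>S. inf _ (principal S)"], auto)
    then show "continuous (at (clock j t) within {clock j t..}) (\<lambda>u. driver (\<phi> j) u w)"
      unfolding continuous_within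
      using additive_process.right_continuous[OF additive_driver w clock_ge0[OF t]] by simp
    show "\<forall>\<^sub>F s in at_right t. clock j s \<in> {clock j t..}"
      unfolding eventually_at_filter by (auto intro!: always_eventually monoD[OF clock_mono])
    show "(clock j \<longlongrightarrow> clock j t) (at_right t)"
      using clock_cont[of t j] unfolding isCont_def by (rule tendsto_within_subset) simp
  qed
  note lim = this
  have "((\<lambda>s. V 0 w + (\<Sum>j\<in>J. driver (\<phi> j) (clock j s) w - driver (\<phi> j) (clock j 0) w)) \<longlongrightarrow>
      V 0 w + (\<Sum>j\<in>J. driver (\<phi> j) (clock j t) w - driver (\<phi> j) (clock j 0) w)) (at_right t)"
    by (intro tendsto_add tendsto_sum tendsto_diff tendsto_const lim)
  moreover have "\<forall>\<^sub>F s in at_right t. V 0 w + (\<Sum>j\<in>J. driver (\<phi> j) (clock j s) w - driver (\<phi> j) (clock j 0) w) = V s w"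
    unfolding eventually_at_right_field
    by (intro exI[of _ "t + 1"] conjI allI impI J(2)[symmetric]) (use t in auto)
  ultimately have "((\<lambda>s. V s w) \<longlongrightarrow>
      V 0 w + (\<Sum>j\<in>J. driver (\<phi> j) (clock j t) w - driver (\<phi> j) (clock j 0) w)) (at_right t)"
    by (rule Lim_transform_eventually)
  then show ?thesis
    using J(2)[of t] t by simp
qed

lemma V_left_limits:
  assumes w: "w \<in> space M" and t: "0 < t"
  shows "\<exists>l. ((\<lambda>s. V s w) \<longlongrightarrow> l) (at_left t)"
proof -
  obtain J where J: "finite J" "\<And>s. 0 \<le> s \<Longrightarrow> s \<le> t \<Longrightarrow>
      V s w = V 0 w + (\<Sum>j\<in>J. driver (\<phi> j) (clock j s) w - driver (\<phi> j) (clock j 0) w)"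
    using V_sum[of t] w by blast
  have "\<exists>l. ((\<lambda>s. driver (\<phi> j) (clock j s) w) \<longlongrightarrow> l) (at_left t)" for j
  (* Either the clock stands still before \<open>t\<close>, or it approaches its value at \<open>t\<close> strictly from below and the left
     limit of the driving process is inherited. *)
  proof (cases "\<exists>s0<t. clock j s0 = clock j t")
    case True
    then obtain s0 where s0: "s0 < t" "clock j s0 = clock j t" by blast
    have "\<forall>\<^sub>F s in at_left t. driver (\<phi> j) (clock j t) w = driver (\<phi> j) (clock j s) w"
      unfolding eventually_at_left_field
    proof (intro exI[of _ s0] conjI allI impI s0)
      fix s assume "s0 < s" "s < t"
      then have "clock j s = clock j t"
        using monoD[OF clock_mono[of j], of s0 s] monoD[OF clock_mono[of j], of s t] s0 by simp
      then show "driver (\<phi> j) (clock j t) w = driver (\<phi> j) (clock j s) w" by simp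
    qed
    then have "((\<lambda>s. driver (\<phi> j) (clock j s) w) \<longlongrightarrow> driver (\<phi> j) (clock j t) w) (at_left t)"
      by (rule Lim_transform_eventually[OF tendsto_const])
    then show ?thesis by blast
  next
    case False
    have less: "clock j s < clock j t" if "s < t" for s
      using monoD[OF clock_mono[of j], of s t] False that by fastforce
    have "0 < clock j t" using less[OF t] clock_nonneg[of j] by simp
    then obtain l where l: "((\<lambda>u. driver (\<phi> j) u w) \<longlongrightarrow> l) (at_left (clock j t))"
      using additive_process.left_limits[OF additive_driver w] by blast
    have "filterlim (clock j) (at_left (clock j t)) (at_left t)"
      unfolding filterlim_at
    proof
      show "\<forall>\<^sub>F s in at_left t. clock j s \<in> {..<clock j t} \<and> clock j s \<noteq> clock j t"
        unfolding eventually_at_filter using less by (auto intro!: always_eventually dest: less_imp_neq)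
      show "(clock j \<longlongrightarrow> clock j t) (at_left t)"
        using clock_cont[of t j] unfolding isCont_def by (rule tendsto_within_subset) simp
    qed
    then show ?thesis
      using filterlim_compose[OF l] by blast
  qed
  then have "\<forall>j. \<exists>l. ((\<lambda>s. driver (\<phi> j) (clock j s) w) \<longlongrightarrow> l) (at_left t)"
    by blast
  from choice[OF this] obtain l where l: "\<And>j. ((\<lambda>s. driver (\<phi> j) (clock j s) w) \<longlongrightarrow> l j) (at_left t)"
    by blast
  have "((\<lambda>s. V 0 w + (\<Sum>j\<in>J. driver (\<phi> j) (clock j s) w - driver (\<phi> j) (clock j 0) w)) \<longlongrightarrow>
      V 0 w + (\<Sum>j\<in>J. l j - driver (\<phi> j) (clock j 0) w)) (at_left t)"
    by (intro tendsto_add tendsto_sum tendsto_diff tendsto_const l)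
  moreover have "\<forall>\<^sub>F s in at_left t. V 0 w + (\<Sum>j\<in>J. driver (\<phi> j) (clock j s) w - driver (\<phi> j) (clock j 0) w) = V s w"
    unfolding eventually_at_left_field
    by (intro exI[of _ 0] conjI allI impI J(2)[symmetric]) (use t in auto)
  ultimately have "((\<lambda>s. V s w) \<longlongrightarrow> V 0 w + (\<Sum>j\<in>J. l j - driver (\<phi> j) (clock j 0) w)) (at_left t)"
    by (rule Lim_transform_eventually)
  then show ?thesis by blast
qed

text \<open>Group the increments of all summands over all the intervals by the time interval they belong to.\<close>
lemma V_independent_increments:
  fixes n :: nat and t :: "nat \<Rightarrow> real"
  assumes t0: "0 \<le> t 0" and t_less: "\<And>i. i < n \<Longrightarrow> t i < t (Suc i)"
  shows "indep_vars (\<lambda>_. borel) (\<lambda>i w. V (t (Suc i)) w - V (t i) w) {..<n}"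
proof -
  have t_mono: "t i \<le> t k" if "i \<le> k" "k \<le> n" for i k
    using that
  proof (induction k rule: dec_induct)
    case (step m)
    then show ?case using t_less[of m] by simp
  qed simp
  have t_ge0: "0 \<le> t i" if "i \<le> n" for i
    using t_mono[of 0 i] that t0 by simp
  obtain J where J: "finite J" "\<And>s u w. 0 \<le> s \<Longrightarrow> s \<le> t n \<Longrightarrow> 0 \<le> u \<Longrightarrow> u \<le> t n \<Longrightarrow> w \<in> space M \<Longrightarrow>
      V u w - V s w = (\<Sum>j\<in>J. driver (\<phi> j) (clock j u) w - driver (\<phi> j) (clock j s) w)"
    using V_increments[of "t n"] by blast
  let ?I = "J \<times> {..<n}"
  have disj: "disjoint_family_on (\<lambda>i. {t i<..t (Suc i)}) {..<n}"
    unfolding disjoint_family_on_def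
  proof (intro ballI impI)
    fix i k assume "i \<in> {..<n}" "k \<in> {..<n}" "i \<noteq> k"
    then show "{t i<..t (Suc i)} \<inter> {t k<..t (Suc k)} = {}"
      using t_mono[of "Suc i" k] t_mono[of "Suc k" i] by (cases i k rule: linorder_cases) auto
  qed
  have "indep_vars (\<lambda>_. borel) (\<lambda>x w. driver (\<phi> (fst x)) (clock (fst x) (t (Suc (snd x)))) w
      - driver (\<phi> (fst x)) (clock (fst x) (t (snd x))) w) ?I"
  proof (rule indep_vars_driver_increments)
    show "disjoint_family_on (\<lambda>x. {clock (fst x) (t (snd x))<..clock (fst x) (t (Suc (snd x)))}) {x \<in> ?I. \<phi> (fst x) = c}" for c
      using clock_pieces_disjoint[of "{..<n}" t "\<lambda>i. t (Suc i)" J c] t_ge0 t_less disj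
      by (simp add: less_imp_le)
    show "0 \<le> clock (fst x) (t (snd x)) \<and> clock (fst x) (t (snd x)) \<le> clock (fst x) (t (Suc (snd x)))" if "x \<in> ?I" for x
      using that t_ge0 t_mono by (auto intro!: clock_ge0 monoD[OF clock_mono])
  qed (use J in auto)
  then have "indep_vars (\<lambda>_. borel) (\<lambda>i w. \<Sum>x\<in>J \<times> {i}. driver (\<phi> (fst x)) (clock (fst x) (t (Suc (snd x)))) w
      - driver (\<phi> (fst x)) (clock (fst x) (t (snd x))) w) {..<n}"
    by (rule indep_vars_group_sums) (use J(1) in \<open>auto simp: disjoint_family_on_def\<close>)
  then have "indep_vars (\<lambda>_. borel) (\<lambda>i w. \<Sum>j\<in>J. driver (\<phi> j) (clock j (t (Suc i))) w
      - driver (\<phi> j) (clock j (t i)) w) {..<n}"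
    by (simp add: sum.cartesian_product')
  moreover have "indep_vars (\<lambda>_. borel) (\<lambda>i w. \<Sum>j\<in>J. driver (\<phi> j) (clock j (t (Suc i))) w
      - driver (\<phi> j) (clock j (t i)) w) {..<n} \<longleftrightarrow> ?thesis"
  proof (rule indep_vars_cong_space)
    show "(\<Sum>j\<in>J. driver (\<phi> j) (clock j (t (Suc i))) w - driver (\<phi> j) (clock j (t i)) w) = V (t (Suc i)) w - V (t i) w"
      if "i \<in> {..<n}" "w \<in> space M" for i w
      using J(2)[of "t i" "t (Suc i)" w] that t_ge0[of i] t_ge0[of "Suc i"] t_mono[of i n] t_mono[of "Suc i" n]
      by simp
  qed
  ultimately show ?thesis by simp
qed

lemma additive_process_V: "additive_process M V"
proof
  show "V t \<in> borel_measurable M" if "0 \<le> t" for t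
    using that by (rule V_measurable)
  show "AE w in M. V 0 w = 0" by (rule V_start)
  show "((\<lambda>s. prob {w \<in> space M. norm (V s w - V t w) > e}) \<longlongrightarrow> 0) (at t within {0..})"
    if "0 \<le> t" "0 < e" for t e
    using that by (rule V_stochastically_continuous)
  show "indep_vars (\<lambda>_. borel) (\<lambda>i w. V (t (Suc i)) w - V (t i) w) {..<n}"
    if "0 \<le> t 0" "\<And>i. i < n \<Longrightarrow> t i < t (Suc i)" for n and t :: "nat \<Rightarrow> real"
    using that by (rule V_independent_increments)
  show "((\<lambda>s. V s w) \<longlongrightarrow> V t w) (at_right t)" if "w \<in> space M" "0 \<le> t" for w t
    using that by (rule V_right_continuous)
  show "\<exists>l. ((\<lambda>s. V s w) \<longlongrightarrow> l) (at_left t)" if "w \<in> space M" "0 < t" for w t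
    using that by (rule V_left_limits)
qed

end

section \<open>The rescaled sum\<close>

context independent_levy_pair
begin

text \<open>One clock for \<open>Y\<close> and one for \<open>Z\<close>, so disjointness of clocks is vacuous.\<close>
lemma superposition_scaled:
  assumes "0 < q" "q < p"
  shows "superposition M Y Z (\<lambda>c. c) (\<lambda>c t. (if c then q else p - q) * t)
    (\<lambda>t w. Y (q * t) w + Z ((p - q) * t) w)"
proof
  let ?clock = "\<lambda>c t. (if c then q else p - q) * t"
  let ?V = "\<lambda>t w. Y (q * t) w + Z ((p - q) * t) w"
  show "mono (?clock c)" for c
    using assms by (auto intro!: monoI mult_left_mono)
  show "isCont (?clock c) t" for c t
    by (intro continuous_intros)
  show "?V 0 \<in> borel_measurable M"
    by (intro borel_measurable_add) (use driver_measurable[of 0 True] driver_measurable[of 0 False] in \<open>simp_all add: driver_def\<close>)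
  show "AE w in M. ?V 0 w = 0"
    using Y.start Z.start by eventually_elim simp
  show "\<exists>J. finite J \<and> (\<forall>t w. 0 \<le> t \<longrightarrow> t \<le> T \<longrightarrow> w \<in> space M \<longrightarrow>
        ?V t w = ?V 0 w + (\<Sum>c\<in>J. driver c (?clock c t) w - driver c (?clock c 0) w))" for T
    by (intro exI[of _ UNIV]) (auto simp: UNIV_bool driver_def)
qed auto

text \<open>Rescaling preserves the equality of the lengths of the intervals \<open>(s, t]\<close> and \<open>(s + h, t + h]\<close>.\<close>
lemma levy_process_scaled_sum:
  assumes q: "0 < q" "q < p"
  shows "levy_process M (\<lambda>t w. Y (q * t) w + Z ((p - q) * t) w)"
proof -
  interpret W: superposition M Y Z "\<lambda>c. c" "\<lambda>c t. (if c then q else p - q) * t"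
      "\<lambda>t w. Y (q * t) w + Z ((p - q) * t) w"
    by (rule superposition_scaled[OF q])
  let ?W = "\<lambda>t w. Y (q * t) w + Z ((p - q) * t) w"
  have increasing: "distr M borel (\<lambda>w. ?W (t + h) w - ?W (s + h) w) = distr M borel (\<lambda>w. ?W t w - ?W s w)"
    if "0 \<le> s" "s \<le> t" "0 \<le> h" for s t h
  proof -
    let ?len = "\<lambda>c. if c then q else p - q"
    have "distr M borel (\<lambda>w. \<Sum>c\<in>UNIV. driver c (?len c * (t + h)) w - driver c (?len c * (s + h)) w)
        = distr M borel (\<lambda>w. \<Sum>c\<in>UNIV. driver c (?len c * t) w - driver c (?len c * s) w)"
    proof (rule distr_sum_driver_increments_cong[where \<phi>="\<lambda>c. c"])
      have "0 \<le> ?len c" for c using q by simp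
      then show "0 \<le> ?len c * s \<and> ?len c * s \<le> ?len c * t"
          "0 \<le> ?len c * (s + h) \<and> ?len c * (s + h) \<le> ?len c * (t + h)" for c
        using that by (meson mult_left_mono mult_nonneg_nonneg add_nonneg_nonneg add_right_mono)+
      show "?len c * (t + h) - ?len c * (s + h) = ?len c * t - ?len c * s" for c
        by (simp only: distrib_left)
    qed (auto simp: disjoint_family_on_def)
    then show ?thesis
      by (simp add: UNIV_bool driver_def algebra_simps)
  qed
  have "distr M borel (\<lambda>w. ?W (t + h) w - ?W (s + h) w) = distr M borel (\<lambda>w. ?W t w - ?W s w)"
    if "0 \<le> s" "0 \<le> t" "0 \<le> h" for s t h
  proof (cases "s \<le> t")
    case True
    then show ?thesis using increasing that by simp
  next
    case False
    show ?thesis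
    proof (rule distr_increments_swap)
      show "distr M borel (\<lambda>w. ?W (s + h) w - ?W (t + h) w) = distr M borel (\<lambda>w. ?W s w - ?W t w)"
        using False that by (intro increasing) simp_all
    qed (use that in \<open>auto intro!: W.V_measurable\<close>)
  qed
  then show ?thesis
    by (intro levy_process.intro levy_process_axioms.intro W.additive_process_V)
qed

end

section \<open>The alternating process\<close>

locale alternating_process = independent_levy_pair M Y Z
  for M :: "'w measure" and Y Z :: "real \<Rightarrow> 'w \<Rightarrow> 'a::euclidean_space" +
  fixes X :: "real \<Rightarrow> 'w \<Rightarrow> 'a" and p q :: real
  assumes q_pos: "0 < q" and q_less: "q < p"
    and X_start_measurable: "X 0 \<in> borel_measurable M"
    and X_start: "AE w in M. X 0 w = 0"
    and X_Y: "\<And>n t w. w \<in> space M \<Longrightarrow> real n * p < t \<Longrightarrow> t \<le> real n * p + q \<Longrightarrow>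
          X t w = X (real n * p) w + Y t w - Y (real n * p) w"
    and X_Z: "\<And>n t w. w \<in> space M \<Longrightarrow> real n * p + q < t \<Longrightarrow> t \<le> (real n + 1) * p \<Longrightarrow>
          X t w = X (real n * p + q) w + Z t w - Z (real n * p + q) w"
begin

text \<open>The phase \<open>(True, k)\<close> is the part of period \<open>k\<close> in which \<open>X\<close> follows \<open>Y\<close>, and \<open>(False, k)\<close> the part in
  which it follows \<open>Z\<close>.\<close>
definition phase_start :: "bool \<times> nat \<Rightarrow> real" where
  "phase_start x = real (snd x) * p + (if fst x then 0 else q)"

definition phase_end :: "bool \<times> nat \<Rightarrow> real" where
  "phase_end x = real (snd x) * p + (if fst x then q else p)"

text \<open>The clock of a phase runs at unit speed during the phase and stands still before and after it.\<close>
definition phase_clock :: "bool \<times> nat \<Rightarrow> real \<Rightarrow> real" where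
  "phase_clock x t = max (phase_start x) (min (phase_end x) t)"

lemma phase_start_nonneg: "0 \<le> phase_start x"
  using q_pos q_less by (simp add: phase_start_def)

lemma phase_start_less_end: "phase_start x < phase_end x"
  using q_pos q_less by (simp add: phase_start_def phase_end_def)

lemma phase_clock_mono: "mono (phase_clock x)"
  by (auto intro!: monoI simp: phase_clock_def)

lemma phase_clock_ge0: "0 \<le> phase_clock x t"
  using phase_start_nonneg[of x] by (simp add: phase_clock_def)

lemma phase_clock_before: "t \<le> phase_start x \<Longrightarrow> phase_clock x t = phase_start x"
  using phase_start_less_end[of x] by (simp add: phase_clock_def)

lemma phase_clock_after: "phase_end x \<le> t \<Longrightarrow> phase_clock x t = phase_end x"
  using phase_start_less_end[of x] by (simp add: phase_clock_def)

lemma phase_clock_within: "phase_start x \<le> t \<Longrightarrow> t \<le> phase_end x \<Longrightarrow> phase_clock x t = t"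
  by (simp add: phase_clock_def)

lemma phases_disjoint:
  assumes "x \<noteq> y" "fst x = fst y"
  shows "{phase_start x<..phase_end x} \<inter> {phase_start y<..phase_end y} = {}"
proof -
  have ordered: "phase_end x \<le> phase_start y" if "snd x < snd y" "fst x = fst y" for x y
  proof -
    have "real (Suc (snd x)) * p \<le> real (snd y) * p"
      using that q_pos q_less by (intro mult_right_mono) auto
    then show ?thesis
      using that q_pos q_less by (auto simp: phase_start_def phase_end_def algebra_simps)
  qed
  have "snd x < snd y \<or> snd y < snd x"
    using assms by (auto simp: prod_eq_iff)
  then show ?thesis
    using ordered[of x y] ordered[of y x] assms by auto
qed

lemma phase_clock_range: "{phase_clock x s<..phase_clock x t} \<subseteq> {phase_start x<..phase_end x}"
  using phase_start_less_end[of x] by (auto simp: phase_clock_def)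

text \<open>Induction on the number of periods. On the new period all earlier clocks have stopped, so their contribution
  is \<open>X (N * p) - X 0\<close>, and the two clocks of the new period reproduce the recursive definition of \<open>X\<close>.\<close>
lemma X_decomposition:
  assumes w: "w \<in> space M"
  shows "0 \<le> t \<Longrightarrow> t \<le> real N * p \<Longrightarrow>
    X t w = X 0 w + (\<Sum>x\<in>UNIV \<times> {..<N}. driver (fst x) (phase_clock x t) w - driver (fst x) (phase_start x) w)"
proof (induction N arbitrary: t)
  case 0
  then show ?case by simp
next
  case (Suc N)
  define D where "D c t = driver c (phase_clock (c, N) t) w - driver c (phase_start (c, N)) w" for c t
  have split: "(\<Sum>x\<in>UNIV \<times> {..<Suc N}. driver (fst x) (phase_clock x t) w - driver (fst x) (phase_start x) w)
      = (\<Sum>x\<in>UNIV \<times> {..<N}. driver (fst x) (phase_clock x t) w - driver (fst x) (phase_start x) w)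
        + D True t + D False t" for t
    by (simp only: sum.cartesian_product' fst_conv) (simp add: UNIV_bool D_def)
  show ?case
  proof (cases "t \<le> real N * p")
    case True
    then have "D True t = 0" "D False t = 0"
      using q_pos phase_clock_before[of t "(True, N)"] phase_clock_before[of t "(False, N)"]
      by (simp_all add: D_def phase_start_def)
    then show ?thesis
      using Suc.IH[OF Suc.prems(1) True] split[of t] by simp
  next
    case False
    have Np: "0 \<le> real N * p" using q_pos q_less by simp
    have "phase_clock x t = phase_clock x (real N * p)" if "x \<in> UNIV \<times> {..<N}" for x
    proof -
      have "real (Suc (snd x)) * p \<le> real N * p"
        using that q_pos q_less by (intro mult_right_mono) auto
      then have "phase_end x \<le> real N * p"
        using q_less by (auto simp: phase_end_def algebra_simps)
      then show ?thesis
        using False by (simp add: phase_clock_after)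
    qed
    then have past: "X 0 w + (\<Sum>x\<in>UNIV \<times> {..<N}. driver (fst x) (phase_clock x t) w - driver (fst x) (phase_start x) w)
        = X (real N * p) w"
      using Suc.IH[OF Np order_refl] by simp
    have ends: "phase_start (True, N) = real N * p" "phase_end (True, N) = real N * p + q"
        "phase_start (False, N) = real N * p + q" "phase_end (False, N) = (real N + 1) * p"
      by (simp_all add: phase_start_def phase_end_def algebra_simps)
    have "X t w = X (real N * p) w + D True t + D False t"
    proof (cases "t \<le> real N * p + q")
      case True
      then show ?thesis
        using X_Y[OF w, of N t] False phase_clock_within[of "(True, N)" t] phase_clock_before[of t "(False, N)"] ends
        by (simp add: D_def driver_def)
    next
      case beyond: False
      have "D True t = Y (real N * p + q) w - Y (real N * p) w" "D False t = Z t w - Z (real N * p + q) w"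
        using beyond Suc.prems(2) phase_clock_after[of "(True, N)" t] phase_clock_within[of "(False, N)" t] ends
        by (simp_all add: D_def driver_def algebra_simps)
      moreover have "X (real N * p + q) w = X (real N * p) w + Y (real N * p + q) w - Y (real N * p) w"
        using X_Y[OF w, of N "real N * p + q"] q_pos by simp
      moreover have "X t w = X (real N * p + q) w + Z t w - Z (real N * p + q) w"
        using X_Z[OF w, of N t] beyond Suc.prems(2) by (simp add: algebra_simps)
      ultimately show ?thesis by simp
    qed
    then show ?thesis
      using past split[of t] by simp
  qed
qed

sublocale X: superposition M Y Z fst phase_clock X
proof
  show "mono (phase_clock x)" for x by (rule phase_clock_mono)
  show "isCont (phase_clock x) t" for x t
    unfolding phase_clock_def by (intro continuous_intros)
  show "0 \<le> phase_clock x 0" for x by (rule phase_clock_ge0)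
  show "{phase_clock x 0<..phase_clock x T} \<inter> {phase_clock y 0<..phase_clock y T} = {}"
    if "x \<noteq> y" "fst x = fst y" for x y T
    using phases_disjoint[OF that] phase_clock_range[of x 0 T] phase_clock_range[of y 0 T] by blast
  show "\<exists>J. finite J \<and> (\<forall>t w. 0 \<le> t \<longrightarrow> t \<le> T \<longrightarrow> w \<in> space M \<longrightarrow>
      X t w = X 0 w + (\<Sum>x\<in>J. driver (fst x) (phase_clock x t) w - driver (fst x) (phase_clock x 0) w))" for T
  proof -
    have "0 < p" using q_pos q_less by simp
    then obtain N where N: "T < real N * p"
      using reals_Archimedean3 by blast
    have "phase_clock x 0 = phase_start x" for x
      by (rule phase_clock_before[OF phase_start_nonneg])
    then have "X t w = X 0 w + (\<Sum>x\<in>UNIV \<times> {..<N}. driver (fst x) (phase_clock x t) w - driver (fst x) (phase_clock x 0) w)"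
      if "0 \<le> t" "t \<le> T" "w \<in> space M" for t w
      using X_decomposition[OF that(3,1), of N] N that(2) by simp
    moreover have "finite (UNIV \<times> {..<N} :: (bool \<times> nat) set)" by simp
    ultimately show ?thesis by blast
  qed
qed (use X_start_measurable X_start in auto)

lemma X_increment:
  assumes "w \<in> space M" "0 \<le> s" "s \<le> real N * p" "0 \<le> t" "t \<le> real N * p"
  shows "X t w - X s w =
    (\<Sum>x\<in>UNIV \<times> {..<N}. driver (fst x) (phase_clock x t) w - driver (fst x) (phase_clock x s) w)"
  using X_decomposition[OF assms(1), of s N] X_decomposition[OF assms(1), of t N] assms
  by (simp add: sum_subtractf)

lemma phase_clocks_disjoint:
  "disjoint_family_on (\<lambda>x. {phase_clock x s<..phase_clock x t}) {x \<in> J. fst x = c}"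
  unfolding disjoint_family_on_def
proof (intro ballI impI)
  fix x y assume "x \<in> {x \<in> J. fst x = c}" "y \<in> {x \<in> J. fst x = c}" and neq: "x \<noteq> y"
  then have "fst x = fst y" by simp
  then have "{phase_start x<..phase_end x} \<inter> {phase_start y<..phase_end y} = {}"
    by (rule phases_disjoint[OF neq])
  then show "{phase_clock x s<..phase_clock x t} \<inter> {phase_clock y s<..phase_clock y t} = {}"
    using phase_clock_range[of x s t] phase_clock_range[of y s t] by blast
qed

lemma phase_clock_shift: "phase_clock (c, Suc k) (t + p) = phase_clock (c, k) t + p"
proof -
  have "phase_start (c, Suc k) = phase_start (c, k) + p" "phase_end (c, Suc k) = phase_end (c, k) + p"
    by (simp_all add: phase_start_def phase_end_def distrib_right)
  then show ?thesis
    by (auto simp: phase_clock_def max_def min_def)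
qed

text \<open>Shifting time by \<open>p\<close> turns the phase \<open>k\<close> into the phase \<open>Suc k\<close>, and phase \<open>0\<close> is over by time \<open>p\<close>. So the
  two increments to be compared are made of driver increments over intervals of equal lengths.\<close>
lemma semi_levy_process_X: "semi_levy_process M X p"
proof -
  have p: "0 < p" using q_pos q_less by simp
  have increasing: "distr M borel (\<lambda>w. X (t + p) w - X (s + p) w) = distr M borel (\<lambda>w. X t w - X s w)"
    if st: "0 \<le> s" "s \<le> t" for s t
  proof -
    obtain N where N: "t < real N * p"
      using reals_Archimedean3[OF p] by blast
    let ?J = "UNIV \<times> {..<N} :: (bool \<times> nat) set"
    have early: "X t w - X s w = (\<Sum>x\<in>?J. driver (fst x) (phase_clock x t) w - driver (fst x) (phase_clock x s) w)"
      if "w \<in> space M" for w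
      using that st N by (intro X_increment) auto
    have late: "X (t + p) w - X (s + p) w
        = (\<Sum>x\<in>?J. driver (fst x) (phase_clock x t + p) w - driver (fst x) (phase_clock x s + p) w)"
      if w: "w \<in> space M" for w
    proof -
      have "X (t + p) w - X (s + p) w = (\<Sum>x\<in>UNIV \<times> {..<Suc N}. driver (fst x) (phase_clock x (t + p)) w
          - driver (fst x) (phase_clock x (s + p)) w)"
        using w st N p by (intro X_increment) (auto simp: algebra_simps)
      also have "\<dots> = (\<Sum>c\<in>UNIV. \<Sum>k<Suc N. driver c (phase_clock (c, k) (t + p)) w - driver c (phase_clock (c, k) (s + p)) w)"
        by (simp only: sum.cartesian_product' fst_conv)
      also have "\<dots> = (\<Sum>c\<in>UNIV. \<Sum>k<N. driver c (phase_clock (c, k) t + p) w - driver c (phase_clock (c, k) s + p) w)"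
      proof -
        have "phase_end (c, 0) \<le> s + p" "phase_end (c, 0) \<le> t + p" for c
          using st q_less by (auto simp: phase_end_def)
        then have "phase_clock (c, 0) (t + p) = phase_end (c, 0)" "phase_clock (c, 0) (s + p) = phase_end (c, 0)" for c
          using phase_clock_after by blast+
        then show ?thesis
          by (simp only: sum.lessThan_Suc_shift phase_clock_shift diff_self add_0_left)
      qed
      finally show ?thesis
        by (simp only: sum.cartesian_product' fst_conv)
    qed
    have "distr M borel (\<lambda>w. X (t + p) w - X (s + p) w) = distr M borel
        (\<lambda>w. \<Sum>x\<in>?J. driver (fst x) (phase_clock x t + p) w - driver (fst x) (phase_clock x s + p) w)"
      by (intro distr_cong late) auto
    also have "\<dots> = distr M borel
        (\<lambda>w. \<Sum>x\<in>?J. driver (fst x) (phase_clock x t) w - driver (fst x) (phase_clock x s) w)"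
    proof (rule distr_sum_driver_increments_cong)
      show "disjoint_family_on (\<lambda>x. {phase_clock x s + p<..phase_clock x t + p}) {x \<in> ?J. fst x = c}" for c
      proof -
        have "{phase_clock x s + p<..phase_clock x t + p} \<inter> {phase_clock y s + p<..phase_clock y t + p} = {}"
          if xy: "x \<in> {x \<in> ?J. fst x = c}" "y \<in> {x \<in> ?J. fst x = c}" "x \<noteq> y" for x y
        proof (rule ccontr)
          assume "\<not> ?thesis"
          then obtain u where "u \<in> {phase_clock x s + p<..phase_clock x t + p}"
              "u \<in> {phase_clock y s + p<..phase_clock y t + p}"
            by blast
          then have "u - p \<in> {phase_clock x s<..phase_clock x t} \<inter> {phase_clock y s<..phase_clock y t}"
            by auto
          then show False
            unfolding disjoint_family_onD[OF phase_clocks_disjoint[of s t ?J c] xy] by simp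
        qed
        then show ?thesis unfolding disjoint_family_on_def by (intro ballI impI)
      qed
      show "0 \<le> phase_clock x s \<and> phase_clock x s \<le> phase_clock x t" for x
        using st by (auto intro: phase_clock_ge0 monoD[OF phase_clock_mono])
      then show "0 \<le> phase_clock x s + p \<and> phase_clock x s + p \<le> phase_clock x t + p" for x
        using p by (simp add: add_nonneg_nonneg less_imp_le)
    qed (auto intro: phase_clocks_disjoint)
    also have "\<dots> = distr M borel (\<lambda>w. X t w - X s w)"
      by (intro distr_cong early[symmetric]) auto
    finally show ?thesis .
  qed
  have "distr M borel (\<lambda>w. X (t + p) w - X (s + p) w) = distr M borel (\<lambda>w. X t w - X s w)"
    if "0 \<le> s" "0 \<le> t" for s t
  proof (cases "s \<le> t")
    case True
    then show ?thesis using increasing that by simp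
  next
    case False
    show ?thesis
    proof (rule distr_increments_swap)
      show "distr M borel (\<lambda>w. X (s + p) w - X (t + p) w) = distr M borel (\<lambda>w. X s w - X t w)"
        using False that by (intro increasing) simp_all
    qed (use that p in \<open>auto intro!: X.V_measurable\<close>)
  qed
  then show ?thesis
    using p by (intro semi_levy_process.intro semi_levy_process_axioms.intro X.additive_process_V)
qed

text \<open>Cut the intervals \<open>(0, q * n]\<close> and \<open>(0, (p - q) * n]\<close> that drive the rescaled sum into \<open>n\<close> equal pieces; these have
  the lengths of the first \<open>n\<close> pairs of phases.\<close>
lemma distr_skeletons:
  "distr M borel (\<lambda>w. X (real n * p) w - X 0 w) =
   distr M borel (\<lambda>w. (Y (q * real n) w + Z ((p - q) * real n) w) - (Y (q * 0) w + Z ((p - q) * 0) w))"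
proof -
  let ?J = "UNIV \<times> {..<n} :: (bool \<times> nat) set"
  let ?len = "\<lambda>c. if c then q else p - q"
  let ?u = "\<lambda>x. ?len (fst x) * real (snd x)" and ?v = "\<lambda>x. ?len (fst x) * real (Suc (snd x))"
  have np: "0 \<le> real n * p" using q_pos q_less by simp
  have X: "X (real n * p) w - X 0 w =
      (\<Sum>x\<in>?J. driver (fst x) (phase_end x) w - driver (fst x) (phase_start x) w)" if "w \<in> space M" for w
  proof -
    have "phase_clock x (real n * p) = phase_end x" if "x \<in> ?J" for x
    proof -
      have "real (Suc (snd x)) * p \<le> real n * p"
        using that q_pos q_less by (intro mult_right_mono) auto
      then show ?thesis
        using q_less by (intro phase_clock_after) (auto simp: phase_end_def algebra_simps)
    qed
    then show ?thesis
      using X_decomposition[OF that np order_refl] by simp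
  qed
  have W: "(Y (q * real n) w + Z ((p - q) * real n) w) - (Y (q * 0) w + Z ((p - q) * 0) w) =
      (\<Sum>x\<in>?J. driver (fst x) (?v x) w - driver (fst x) (?u x) w)" for w
  proof -
    have "(\<Sum>x\<in>?J. driver (fst x) (?v x) w - driver (fst x) (?u x) w)
        = (\<Sum>c\<in>UNIV. \<Sum>k<n. driver c (?len c * real (Suc k)) w - driver c (?len c * real k) w)"
      by (simp only: sum.cartesian_product' fst_conv snd_conv)
    also have "\<dots> = (\<Sum>c\<in>UNIV. driver c (?len c * real n) w - driver c (?len c * real 0) w)"
      by (intro sum.cong refl sum_lessThan_telescope)
    finally show ?thesis
      by (simp add: UNIV_bool driver_def)
  qed
  have "distr M borel (\<lambda>w. X (real n * p) w - X 0 w) =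
      distr M borel (\<lambda>w. \<Sum>x\<in>?J. driver (fst x) (phase_end x) w - driver (fst x) (phase_start x) w)"
    by (intro distr_cong X) auto
  also have "\<dots> = distr M borel (\<lambda>w. \<Sum>x\<in>?J. driver (fst x) (?v x) w - driver (fst x) (?u x) w)"
  proof (rule distr_sum_driver_increments_cong)
    show "0 \<le> phase_start x \<and> phase_start x \<le> phase_end x" for x
      using phase_start_nonneg less_imp_le[OF phase_start_less_end] by simp
    show "disjoint_family_on (\<lambda>x. {phase_start x<..phase_end x}) {x \<in> ?J. fst x = c}" for c
      using phases_disjoint by (auto simp: disjoint_family_on_def)
    show "0 \<le> ?u x \<and> ?u x \<le> ?v x" for x
      using q_pos q_less by (auto intro!: mult_left_mono)
    show "disjoint_family_on (\<lambda>x. {?u x<..?v x}) {x \<in> ?J. fst x = c}" for c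
      unfolding disjoint_family_on_def
    proof (intro ballI impI)
      fix x y assume xy: "x \<in> {x \<in> ?J. fst x = c}" "y \<in> {x \<in> ?J. fst x = c}" "x \<noteq> y"
      have ordered: "?v x \<le> ?u y" if "snd x < snd y" "fst x = fst y" for x y :: "bool \<times> nat"
        using that q_pos q_less by (auto intro!: mult_left_mono)
      have "snd x < snd y \<or> snd y < snd x"
        using xy by (auto simp: prod_eq_iff)
      then show "{?u x<..?v x} \<inter> {?u y<..?v y} = {}"
        using ordered[of x y] ordered[of y x] xy by (auto simp del: of_nat_Suc)
    qed
    show "phase_end x - phase_start x = ?v x - ?u x" for x
      by (simp add: phase_end_def phase_start_def algebra_simps)
  qed simp
  also have "\<dots> = distr M borel (\<lambda>w. (Y (q * real n) w + Z ((p - q) * real n) w) - (Y (q * 0) w + Z ((p - q) * 0) w))"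
    unfolding W ..
  finally show ?thesis .
qed

lemma recurrent_iff:
  "recurrent_process M X \<longleftrightarrow> recurrent_process M (\<lambda>t w. Y (q * t) w + Z ((p - q) * t) w)"
proof -
  let ?W = "\<lambda>t w. Y (q * t) w + Z ((p - q) * t) w"
  interpret SX: semi_levy_process M X p by (rule semi_levy_process_X)
  interpret LW: levy_process M ?W by (rule levy_process_scaled_sum[OF q_pos q_less])
  interpret SW: semi_levy_process M ?W 1
    by unfold_locales (auto intro: LW.stationary_increments)
  have "prob {w \<in> space M. norm (X (real n * p) w - X 0 w) < c} =
      prob {w \<in> space M. norm (?W (real n * 1) w - ?W 0 w) < c}" for n c
  proof -
    have "prob {w \<in> space M. X (real n * p) w - X 0 w \<in> {x. norm x < c}} =
        prob {w \<in> space M. ?W (real n * 1) w - ?W 0 w \<in> {x. norm x < c}}"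
      by (intro prob_eq_of_distr_eq[where N=borel] SX.increment_measurable SW.increment_measurable)
        (use distr_skeletons[of n] q_pos q_less in auto)
    then show ?thesis by simp
  qed
  then show ?thesis
    unfolding SX.recurrent_iff_skeleton_not_summable SW.recurrent_iff_skeleton_not_summable by simp
qed

end

theorem proposition4p1:
  fixes M :: "'w measure"
    and X Y Z :: "real \<Rightarrow> 'w \<Rightarrow> 'a::euclidean_space"
    and p q :: real
  assumes "prob_space M"
    and "levy_process M Y" and "levy_process M Z"
    and "independent_processes M Y Z"
    and "0 < q" and "q < p"
    and "X 0 \<in> borel_measurable M" and "AE w in M. X 0 w = 0"
    and "\<And>(n::nat) t w. w \<in> space M \<Longrightarrow> real n * p < t \<Longrightarrow> t \<le> real n * p + q \<Longrightarrow>
          X t w = X (real n * p) w + Y t w - Y (real n * p) w"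
    and "\<And>(n::nat) t w. w \<in> space M \<Longrightarrow> real n * p + q < t \<Longrightarrow> t \<le> (real n + 1) * p \<Longrightarrow>
          X t w = X (real n * p + q) w + Z t w - Z (real n * p + q) w"
  shows "semi_levy_process M X p \<and>
    levy_process M (\<lambda>t w. Y (q * t) w + Z ((p - q) * t) w) \<and>
    (recurrent_process M X \<longleftrightarrow>
      recurrent_process M (\<lambda>t w. Y (q * t) w + Z ((p - q) * t) w))"
proof -
  interpret alternating_process M Y Z X p q
    using assms by (intro alternating_process.intro independent_levy_pair.intro
        independent_levy_pair_axioms.intro alternating_process_axioms.intro)
  show ?thesis
    using semi_levy_process_X levy_process_scaled_sum[OF q_pos q_less] recurrent_iff by blast
qed

end
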